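(* Let $r,d\ge 1$ and let $S_{r,d}$ be the free solvable group of rank $r$ and derived length $d$. Let $H$ be a finitely generated verbally closed subgroup of $S_{r,d}$ with $r_{ab}(H)=1$. Then $H$ is a retract of $S_{r,d}$.
   Context: For a group $G$, the derived series is $G^{(0)}=G$, $G^{(i+1)}=[G^{(i)},G^{(i)}]$, and $G'=G^{(1)}$. $S_{r,d}=F_r/F_r^{(d)}$, where $F_r$ is the free group of rank $r$; i.e. the free group of rank $r$ in the variety of all solvable groups of derived length at most $d$. For a finitely generated subgroup $H\le G$, $r_{ab}(H)$ denotes the minimal number of generators of the abelian group $HG'/G'$. A subgroup $H\le G$ is verbally closed in $G$ if for every group word $w(x_1,\dots,x_n)$ (without constants) and every $h\in H$, if the equation $w(x_1,\dots,x_n)=h$ has a solution in $G$, then it has a solution in $H$. A subgroup $H\le G$ is a retract of $G$ if there is an endomorphism (retraction) $\rho:G\to H$ of $G$ with image in $H$ that is the identity on $H$. *)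

theory Defs
  imports "HOL-Algebra.Algebra"
begin

text \<open>A letter is a pair (generator, flag); flag True means the inverse of the generator.\<close>

fun reduced_word :: "('a \<times> bool) list \<Rightarrow> bool" where
  "reduced_word [] = True"
| "reduced_word [x] = True"
| "reduced_word (x # y # xs) =
     (\<not> (fst x = fst y \<and> snd x \<noteq> snd y) \<and> reduced_word (y # xs))"

fun push_letter :: "('a \<times> bool) \<Rightarrow> ('a \<times> bool) list \<Rightarrow> ('a \<times> bool) list" where
  "push_letter x [] = [x]"
| "push_letter x (y # ys) =
     (if fst x = fst y \<and> snd x \<noteq> snd y then ys else x # y # ys)"

definition free_group_on :: "'a set \<Rightarrow> ('a \<times> bool) list monoid" where
  "free_group_on S =
     \<lparr> carrier = {w. reduced_word w \<and> fst ` set w \<subseteq> S},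
       monoid.mult = (\<lambda>u v. foldr push_letter u v),
       monoid.one = [] \<rparr>"

definition free_group :: "nat \<Rightarrow> (nat \<times> bool) list monoid" where
  "free_group r = free_group_on {..<r}"

definition free_solvable_group :: "nat \<Rightarrow> nat \<Rightarrow> ((nat \<times> bool) list set) monoid" where
  "free_solvable_group r d =
     free_group r Mod ((derived (free_group r) ^^ d) (carrier (free_group r)))"

definition word_eval :: "('a, 'b) monoid_scheme \<Rightarrow> (nat \<times> bool) list \<Rightarrow> (nat \<Rightarrow> 'a) \<Rightarrow> 'a" where
  "word_eval G w g =
     foldr (\<lambda>(i, b) acc. (if b then inv\<^bsub>G\<^esub> (g i) else g i) \<otimes>\<^bsub>G\<^esub> acc) w \<one>\<^bsub>G\<^esub>"

definition verbally_closed :: "('a, 'b) monoid_scheme \<Rightarrow> 'a set \<Rightarrow> bool" where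
  "verbally_closed G H \<longleftrightarrow>
     (\<forall>w. \<forall>h \<in> H.
        (\<exists>g. g \<in> UNIV \<rightarrow> carrier G \<and> word_eval G w g = h) \<longrightarrow>
        (\<exists>g. g \<in> UNIV \<rightarrow> H \<and> word_eval G w g = h))"

definition is_retract :: "('a, 'b) monoid_scheme \<Rightarrow> 'a set \<Rightarrow> bool" where
  "is_retract G H \<longleftrightarrow>
     (\<exists>\<rho> \<in> hom G G. \<rho> ` carrier G \<subseteq> H \<and> (\<forall>h \<in> H. \<rho> h = h))"

definition finitely_generated_subgroup :: "('a, 'b) monoid_scheme \<Rightarrow> 'a set \<Rightarrow> bool" where
  "finitely_generated_subgroup G H \<longleftrightarrow>
     (\<exists>A. finite A \<and> A \<subseteq> carrier G \<and> H = generate G A)"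

definition min_generators :: "('a, 'b) monoid_scheme \<Rightarrow> nat" where
  "min_generators K =
     (LEAST n. \<exists>A. finite A \<and> card A = n \<and> A \<subseteq> carrier K \<and> generate K A = carrier K)"

definition r_ab :: "('a, 'b) monoid_scheme \<Rightarrow> 'a set \<Rightarrow> nat" where
  "r_ab G H =
     min_generators
       (subgroup_generated (G Mod derived G (carrier G))
          ((\<lambda>h. derived G (carrier G) #>\<^bsub>G\<^esub> h) ` H))"

end

theory Submission
  imports Defs
begin

text \<open>Let \<open>G = F/F\<^sup>(\<^sup>d\<^sup>)\<close> and let \<open>h \<in> H\<close> generate \<open>H\<close> modulo \<open>G'\<close>. Verbal closedness gives
  \<open>H \<inter> G' = H'\<close> and shows that \<open>h\<close> is not a proper power modulo \<open>G'\<close>, so some homomorphism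
  \<open>\<chi> : G \<rightarrow> \<int>\<close> has \<open>\<chi>(h) = 1\<close>. If \<open>H \<inter> G'\<close> is trivial, then \<open>x \<mapsto> h\<^sup>\<chi>\<^sup>(\<^sup>x\<^sup>)\<close> is the retraction.

  To see that the preimage of \<open>H'\<close> lies in \<open>F\<^sup>(\<^sup>i\<^sup>)\<close> for all \<open>i \<le> d\<close>, put \<open>N = F\<^sup>(\<^sup>i\<^sup>)\<close>. An element of \<open>N\<close> is a closed path in the
  Cayley graph of \<open>F/N\<close>, and it lies in \<open>[N, N]\<close> iff it traverses every edge as often forwards as
  backwards (Magnus). The flows of the elements of \<open>H'\<close> form a module \<open>M\<close> over \<open>\<int>[h, h\<^sup>-\<^sup>1]\<close> with
  \<open>M = (h - 1)M\<close>, because \<open>H\<close> is generated by \<open>h\<close> and \<open>H'\<close>. As \<open>h\<close> acts freely on the edges and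
  flows have finite support, \<open>M = 0\<close>: along an orbit, a functional with polynomial coefficients
  kills \<open>(h - 1)\<^sup>n M\<close> for large \<open>n\<close>, and such functionals separate finitely supported flows.\<close>

subsection \<open>The free group of reduced words\<close>

definition inv_letter :: "'a \<times> bool \<Rightarrow> 'a \<times> bool" where
  "inv_letter l = (fst l, \<not> snd l)"

lemma inv_letter_simps [simp]:
  "inv_letter (x, b) = (x, \<not> b)" "fst (inv_letter l) = fst l" "snd (inv_letter l) = (\<not> snd l)"
  "inv_letter (inv_letter l) = l"
  by (auto simp: inv_letter_def)

lemma cancel_iff: "fst l = fst l' \<and> snd l \<noteq> snd l' \<longleftrightarrow> l' = inv_letter l"
  by (cases l; cases l') auto

lemma reduced_word_tl: "reduced_word (l # w) \<Longrightarrow> reduced_word w"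
  by (cases w) auto

lemma reduced_word_push_letter: "reduced_word w \<Longrightarrow> reduced_word (push_letter l w)"
  by (cases w) (auto dest: reduced_word_tl)

lemma set_push_letter: "set (push_letter l w) \<subseteq> insert l (set w)"
  by (cases w) auto

text \<open>So \<open>push_letter l\<close> permutes the reduced words, with inverse
  \<open>push_letter (inv_letter l)\<close>. Letting words act by these permutations yields
  associativity without a confluence argument (van der Waerden's trick).\<close>

lemma push_letter_inv: "reduced_word w \<Longrightarrow> push_letter (inv_letter l) (push_letter l w) = w"
  by (cases w rule: reduced_word.cases) (auto simp: inv_letter_def prod_eq_iff)

lemma push_letter_reduced: "reduced_word (l # w) \<Longrightarrow> push_letter l w = l # w"
  by (cases w) auto

lemma foldr_push_reduced: "reduced_word w \<Longrightarrow> reduced_word (foldr push_letter u w)"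
  by (induction u) (auto intro: reduced_word_push_letter)

lemma set_foldr_push: "set (foldr push_letter u w) \<subseteq> set u \<union> set w"
  by (induction u) (use set_push_letter in fastforce)+

text \<open>If \<open>v\<close> starts with the inverse of \<open>l\<close>, that letter cancels on
  both sides by \<open>push_letter_inv\<close>; otherwise \<open>push_letter l v\<close> is just
  \<open>l # v\<close>.\<close>

lemma foldr_push_push:
  assumes "reduced_word w"
  shows "foldr push_letter (push_letter l v) w = push_letter l (foldr push_letter v w)"
proof (cases v)
  case (Cons m ys)
  show ?thesis
  proof (cases "m = inv_letter l")
    case True
    then show ?thesis
      using Cons push_letter_inv[OF foldr_push_reduced[OF assms], of m ys] by auto
  next
    case False
    then show ?thesis using Cons cancel_iff[of l m] by auto
  qed
qed auto

lemma foldr_push_assoc: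
  assumes "reduced_word w"
  shows "foldr push_letter (foldr push_letter u v) w = foldr push_letter u (foldr push_letter v w)"
  by (induction u) (auto simp: foldr_push_push[OF assms])

lemma foldr_push_Nil: "reduced_word w \<Longrightarrow> foldr push_letter w [] = w"
proof (induction w)
  case (Cons l w)
  then have "foldr push_letter (l # w) [] = push_letter l w"
    using reduced_word_tl[of l w] by simp
  then show ?case using push_letter_reduced[OF Cons.prems] by simp
qed simp

lemma foldr_push_inv:
  "reduced_word v \<Longrightarrow>
     foldr push_letter (rev (map inv_letter u)) (foldr push_letter u v) = v"
  by (induction u arbitrary: v) (auto simp: push_letter_inv foldr_push_reduced)

lemma group_free_group_on: "group (free_group_on S)"
proof (rule groupI)
  fix u assume u: "u \<in> carrier (free_group_on S)"
  have red: "reduced_word u" and set: "fst ` set u \<subseteq> S"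
    using u by (simp_all add: free_group_on_def)
  let ?v = "foldr push_letter (rev (map inv_letter u)) []"
  have "set ?v \<subseteq> inv_letter ` set u"
    using set_foldr_push[of "rev (map inv_letter u)" "[]"] by auto
  then have "fst ` set ?v \<subseteq> S"
    using set by fastforce
  then have "?v \<in> carrier (free_group_on S)"
    by (simp add: free_group_on_def foldr_push_reduced)
  moreover have "?v \<otimes>\<^bsub>free_group_on S\<^esub> u = \<one>\<^bsub>free_group_on S\<^esub>"
    using foldr_push_inv[of "[]" u] red
    by (simp add: free_group_on_def foldr_push_assoc foldr_push_Nil)
  ultimately show "\<exists>v\<in>carrier (free_group_on S). v \<otimes>\<^bsub>free_group_on S\<^esub> u = \<one>\<^bsub>free_group_on S\<^esub>"
    by blast
next
  fix u v assume "u \<in> carrier (free_group_on S)" "v \<in> carrier (free_group_on S)"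
  then show "u \<otimes>\<^bsub>free_group_on S\<^esub> v \<in> carrier (free_group_on S)"
    using set_foldr_push[of u v] by (fastforce simp: free_group_on_def foldr_push_reduced)
qed (auto simp: free_group_on_def foldr_push_assoc)

subsection \<open>Integer functionals on commutators\<close>

text \<open>Additivity is asked for on a subgroup \<open>P\<close> only, because path functionals
  such as \<open>psum\<close> are additive on a normal subgroup \<open>N\<close> but in general not
  on the whole free group.\<close>

lemma (in group) additive_inv:
  fixes f :: "'a \<Rightarrow> int"
  assumes "subgroup P G" and "\<And>x y. x \<in> P \<Longrightarrow> y \<in> P \<Longrightarrow> f (x \<otimes> y) = f x + f y" and "x \<in> P"
  shows "f (inv x) = - f x"
proof -
  have "f (\<one> \<otimes> \<one>) = f \<one> + f \<one>"
    using assms subgroup.one_closed by metis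
  then have "f \<one> = 0" by simp
  moreover have "f (inv x \<otimes> x) = f (inv x) + f x"
    using assms subgroup.m_inv_closed by metis
  ultimately show ?thesis
    using assms(3) subgroup.mem_carrier[OF assms(1)] by simp
qed

lemma (in group) additive_zero_on_generate:
  fixes f :: "'a \<Rightarrow> int"
  assumes P: "subgroup P G" and f: "\<And>x y. x \<in> P \<Longrightarrow> y \<in> P \<Longrightarrow> f (x \<otimes> y) = f x + f y"
    and A: "\<And>a. a \<in> A \<Longrightarrow> a \<in> P \<and> f a = 0" and x: "x \<in> generate G A"
  shows "x \<in> P \<and> f x = 0"
  using x
proof (induction rule: generate.induct)
  case one
  have "f (\<one> \<otimes> \<one>) = f \<one> + f \<one>"
    using P f subgroup.one_closed by metis
  then show ?case using subgroup.one_closed[OF P] by simp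
next
  case (inv a)
  then show ?case
    using A[of a] additive_inv[of P f a] P f subgroup.m_inv_closed[OF P] by auto
next
  case (eng a b)
  then show ?case using f subgroup.m_closed[OF P] by simp
qed (use A in auto)

lemma (in group) additive_derived_zero:
  fixes f :: "'a \<Rightarrow> int"
  assumes P: "subgroup P G" and f: "\<And>x y. x \<in> P \<Longrightarrow> y \<in> P \<Longrightarrow> f (x \<otimes> y) = f x + f y"
    and x: "x \<in> derived G P"
  shows "f x = 0"
proof -
  have "a \<in> P \<and> f a = 0" if a: "a \<in> derived_set G P" for a
  proof -
    from a obtain p q where pq: "p \<in> P" "q \<in> P" "a = p \<otimes> q \<otimes> inv p \<otimes> inv q" by blast
    then show ?thesis
      using f additive_inv[of P f, OF P f] subgroup.m_closed[OF P] subgroup.m_inv_closed[OF P] by simp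
  qed
  then show ?thesis
    using additive_zero_on_generate[of P f, OF P f _ x[unfolded derived_def]] by blast
qed

lemma (in group) conj_nat_pow_invariant:
  fixes f :: "'a \<Rightarrow> int" and n :: nat
  assumes P: "subgroup P G" and h: "h \<in> carrier G"
    and inv: "\<And>p. p \<in> P \<Longrightarrow> h \<otimes> p \<otimes> inv h \<in> P \<and> f (h \<otimes> p \<otimes> inv h) = f p"
    and p: "p \<in> P"
  shows "h [^] n \<otimes> p \<otimes> inv (h [^] n) \<in> P \<and> f (h [^] n \<otimes> p \<otimes> inv (h [^] n)) = f p"
  using p
proof (induction n arbitrary: p)
  case 0
  then show ?case using subgroup.mem_carrier[OF P] by simp
next
  case (Suc n)
  have pc: "p \<in> carrier G" using Suc.prems subgroup.mem_carrier[OF P] by simp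
  have "h [^] Suc n \<otimes> p \<otimes> inv (h [^] Suc n)
      = h [^] n \<otimes> (h \<otimes> p \<otimes> inv h) \<otimes> inv (h [^] n)"
    using h pc by (simp add: inv_mult_group m_assoc)
  then show ?case using Suc.IH inv[OF Suc.prems] by metis
qed

lemma (in group) conj_int_pow_invariant:
  fixes f :: "'a \<Rightarrow> int" and k :: int
  assumes P: "subgroup P G" and h: "h \<in> carrier G"
    and inv: "\<And>p. p \<in> P \<Longrightarrow> h \<otimes> p \<otimes> inv h \<in> P \<and> f (h \<otimes> p \<otimes> inv h) = f p"
    and inv': "\<And>p. p \<in> P \<Longrightarrow> inv h \<otimes> p \<otimes> h \<in> P"
    and p: "p \<in> P"
  shows "h [^] k \<otimes> p \<otimes> inv (h [^] k) \<in> P \<and> f (h [^] k \<otimes> p \<otimes> inv (h [^] k)) = f p"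
proof (cases "k \<ge> 0")
  case True
  then have "h [^] k = h [^] nat k" by (simp only: pow_nat)
  then show ?thesis using conj_nat_pow_invariant[OF P h inv p, of "nat k"] by simp
next
  case False
  \<comment> \<open>Invariance under the inverse of \<open>h\<close> is invariance under
    \<open>h\<close> applied to \<open>inv h \<otimes> q \<otimes> h\<close>, which lies in
    \<open>P\<close> by \<open>inv'\<close>.\<close>
  have "inv h \<otimes> q \<otimes> inv (inv h) \<in> P \<and> f (inv h \<otimes> q \<otimes> inv (inv h)) = f q" if "q \<in> P" for q
  proof -
    have qc: "q \<in> carrier G" using subgroup.mem_carrier[OF P that] .
    have "h \<otimes> (inv h \<otimes> q \<otimes> h) \<otimes> inv h = (h \<otimes> inv h) \<otimes> q \<otimes> (h \<otimes> inv h)"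
      using h qc by (simp only: m_assoc m_closed inv_closed)
    then have "q = h \<otimes> (inv h \<otimes> q \<otimes> h) \<otimes> inv h"
      using h qc by simp
    then show ?thesis using inv[OF inv'[OF that]] inv'[OF that] h by (metis inv_inv)
  qed
  then have "inv h [^] nat (- k) \<otimes> p \<otimes> inv (inv h [^] nat (- k)) \<in> P \<and>
      f (inv h [^] nat (- k) \<otimes> p \<otimes> inv (inv h [^] nat (- k))) = f p"
    by (rule conj_nat_pow_invariant[OF P inv_closed[OF h] _ p])
  moreover have "inv h [^] nat (- k) = h [^] k"
    using False nat_pow_inv[OF h, of "nat (- k)"] by (metis int_pow_def2 not_le)
  ultimately show ?thesis by metis
qed

text \<open>For \<open>u = p s\<close> and \<open>v = q t\<close> with powers \<open>s\<close>,
  \<open>t\<close> of \<open>h\<close>, the commutator of \<open>u\<close> and \<open>v\<close> is a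
  product of \<open>p\<close>, a conjugate of \<open>q\<close> by \<open>s\<close>, a conjugate of
  \<open>inv p\<close> by \<open>t\<close>, and \<open>inv q\<close>. Invariance of \<open>f\<close>
  makes the four values cancel.\<close>

lemma (in group) conj_invariant_derived_zero:
  fixes f :: "'a \<Rightarrow> int"
  assumes P: "subgroup P G" and h: "h \<in> carrier G"
    and f: "\<And>x y. x \<in> P \<Longrightarrow> y \<in> P \<Longrightarrow> f (x \<otimes> y) = f x + f y"
    and inv: "\<And>p. p \<in> P \<Longrightarrow> h \<otimes> p \<otimes> inv h \<in> P \<and> f (h \<otimes> p \<otimes> inv h) = f p"
    and inv': "\<And>p. p \<in> P \<Longrightarrow> inv h \<otimes> p \<otimes> h \<in> P"
    and K: "\<And>a. a \<in> K \<Longrightarrow> \<exists>p \<in> P. \<exists>k::int. a = p \<otimes> h [^] k"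
    and x: "x \<in> derived G K"
  shows "x \<in> P \<and> f x = 0"
proof -
  have "a \<in> P \<and> f a = 0" if a: "a \<in> derived_set G K" for a
  proof -
    from a obtain u v where uv: "u \<in> K" "v \<in> K" "a = u \<otimes> v \<otimes> inv u \<otimes> inv v" by blast
    obtain p k where p: "p \<in> P" "u = p \<otimes> h [^] (k::int)" using K uv by blast
    obtain q l where q: "q \<in> P" "v = q \<otimes> h [^] (l::int)" using K uv by blast
    have c: "p \<in> carrier G" "q \<in> carrier G" using p q subgroup.mem_carrier[OF P] by auto
    define s t where "s = h [^] k" and "t = h [^] l"
    have st: "s \<in> carrier G" "t \<in> carrier G" "s \<otimes> t = t \<otimes> s"
      using h by (auto simp: s_def t_def int_pow_mult[symmetric] add.commute)
    have st': "t \<otimes> inv s = inv s \<otimes> t"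
      using st by (metis inv_closed inv_solve_left inv_solve_right m_assoc m_closed)
    have 1: "a = p \<otimes> (s \<otimes> q \<otimes> inv s) \<otimes> (t \<otimes> inv p \<otimes> inv t) \<otimes> inv q"
    proof -
      have "a = p \<otimes> s \<otimes> q \<otimes> (t \<otimes> inv s) \<otimes> inv p \<otimes> inv t \<otimes> inv q"
        using uv(3) c st p(2) q(2) by (simp add: s_def t_def inv_mult_group m_assoc h)
      then show ?thesis using c st by (simp add: st' m_assoc)
    qed
    have sq: "s \<otimes> q \<otimes> inv s \<in> P \<and> f (s \<otimes> q \<otimes> inv s) = f q"
      unfolding s_def by (rule conj_int_pow_invariant[OF P h inv inv' q(1)])
    have ip: "inv p \<in> P" "inv q \<in> P" using p q subgroup.m_inv_closed[OF P] by auto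
    have tp: "t \<otimes> inv p \<otimes> inv t \<in> P \<and> f (t \<otimes> inv p \<otimes> inv t) = f (inv p)"
      unfolding t_def by (rule conj_int_pow_invariant[OF P h inv inv' ip(1)])
    have "a \<in> P" using 1 sq tp ip p subgroup.m_closed[OF P] by metis
    moreover have "f a = f p + f q + f (inv p) + f (inv q)"
      unfolding 1 using sq tp ip p q f subgroup.m_closed[OF P] by simp
    ultimately show ?thesis using additive_inv[of P f, OF P f] p q by simp
  qed
  then show ?thesis
    using additive_zero_on_generate[of P f, OF P f _ x[unfolded derived_def]] by blast
qed

subsection \<open>Balanced products\<close>

text \<open>Triviality of the image in the free abelian group on the edges.\<close>

definition balanced :: "('e \<times> bool) list \<Rightarrow> bool" where
  "balanced L \<longleftrightarrow> (\<forall>e. count_list L (e, False) = count_list L (e, True))"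

text \<open>This is \<open>word_eval\<close> with an arbitrary index type, so that the indices can
  be edges.\<close>

definition signed_prod :: "('a, 'b) monoid_scheme \<Rightarrow> ('e \<Rightarrow> 'a) \<Rightarrow> ('e \<times> bool) list \<Rightarrow> 'a" where
  "signed_prod G y L =
     foldr (\<lambda>(e, b) acc. (if b then inv\<^bsub>G\<^esub> (y e) else y e) \<otimes>\<^bsub>G\<^esub> acc) L \<one>\<^bsub>G\<^esub>"

lemma signed_prod_simps [simp]:
  "signed_prod G y [] = \<one>\<^bsub>G\<^esub>"
  "signed_prod G y ((e, b) # L) = (if b then inv\<^bsub>G\<^esub> (y e) else y e) \<otimes>\<^bsub>G\<^esub> signed_prod G y L"
  by (auto simp: signed_prod_def)

lemma (in group) signed_prod_in_subgroup:
  assumes "subgroup N G" "\<And>e b. (e, b) \<in> set L \<Longrightarrow> y e \<in> N"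
  shows "signed_prod G y L \<in> N"
  using assms(2)
proof (induction L)
  case (Cons a L)
  obtain e b where a: "a = (e, b)" by (cases a)
  have "y e \<in> N" "signed_prod G y L \<in> N" using Cons a by auto
  then show ?case using a assms(1) by (auto intro: subgroup.m_closed subgroup.m_inv_closed)
qed (use assms in \<open>simp add: subgroup.one_closed\<close>)

lemma (in group) signed_prod_append:
  assumes "\<And>e b. (e, b) \<in> set (L @ L') \<Longrightarrow> y e \<in> carrier G"
  shows "signed_prod G y (L @ L') = signed_prod G y L \<otimes> signed_prod G y L'"
  using assms
proof (induction L)
  case Nil
  then show ?case using signed_prod_in_subgroup[OF subgroup_self, of L' y] by auto
next
  case (Cons a L)
  obtain e b where a: "a = (e, b)" by (cases a)
  have "y e \<in> carrier G" using Cons a by auto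
  moreover have "signed_prod G y L \<in> carrier G" "signed_prod G y L' \<in> carrier G"
    using signed_prod_in_subgroup[OF subgroup_self] Cons.prems by (metis UnCI set_append list.set_intros(2) append_Cons)+
  moreover have "signed_prod G y (L @ L') = signed_prod G y L \<otimes> signed_prod G y L'"
    using Cons by (metis list.set_intros(2) append_Cons)
  ultimately show ?case using a by (simp add: m_assoc)
qed

text \<open>The first factor \<open>z\<close> must recur inverted. Moving that inverse to the front,
  past the product over \<open>L1\<close>, costs one commutator of elements of \<open>N\<close>;
  deleting the pair leaves a shorter balanced list.\<close>

lemma (in group) balanced_signed_prod:
  assumes N: "subgroup N G"
  shows "balanced L \<Longrightarrow> (\<And>e b. (e, b) \<in> set L \<Longrightarrow> y e \<in> N) \<Longrightarrow> signed_prod G y L \<in> derived G N"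
proof (induction "length L" arbitrary: L rule: less_induct)
  case less
  have D: "subgroup (derived G N) G"
    using derived_is_subgroup[OF subgroup.subset[OF N]] .
  show ?case
  proof (cases L)
    case Nil
    then show ?thesis using subgroup.one_closed[OF D] by simp
  next
    case (Cons a L')
    obtain e b where a: "a = (e, b)" by (cases a)
    have "count_list L (e, \<not> b) > 0"
    proof -
      have "count_list L (e, b) > 0" using Cons a by simp
      then show ?thesis using less.prems(1) unfolding balanced_def by (cases b) auto
    qed
    then have "(e, \<not> b) \<in> set L'"
      using Cons a count_list_0_iff[of L "(e, \<not> b)"] by auto
    then obtain L1 L2 where L': "L' = L1 @ (e, \<not> b) # L2" by (meson split_list)
    have L: "L = (e, b) # L1 @ (e, \<not> b) # L2" using Cons a L' by simp
    have bal: "balanced (L1 @ L2)"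
      unfolding balanced_def
    proof
      fix e'
      have "count_list L (e', False) = count_list L (e', True)"
        using less.prems(1) by (simp add: balanced_def)
      then show "count_list (L1 @ L2) (e', False) = count_list (L1 @ L2) (e', True)"
        by (cases b) (auto simp: L split: if_splits)
    qed
    define z where "z = (if b then inv (y e) else y e)"
    have ye: "y e \<in> N" using less.prems(2) L by auto
    have z: "z \<in> N" using ye subgroup.m_inv_closed[OF N] by (simp add: z_def)
    let ?p = "signed_prod G y L1" and ?q = "signed_prod G y L2"
    have yN: "\<And>e b. (e, b) \<in> set (L1 @ L2) \<Longrightarrow> y e \<in> N" using less.prems(2) L by auto
    then have pq: "?p \<in> N" "?q \<in> N" using signed_prod_in_subgroup[OF N] by (metis UnCI set_append)+
    have NC: "\<And>u. u \<in> N \<Longrightarrow> u \<in> carrier G" using subgroup.mem_carrier[OF N] .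
    have c: "z \<in> carrier G" "?p \<in> carrier G" "?q \<in> carrier G" "y e \<in> carrier G"
      using z pq ye NC by auto
    have "signed_prod G y L = z \<otimes> signed_prod G y (L1 @ (e, \<not> b) # L2)"
      by (simp add: L z_def)
    also have "signed_prod G y (L1 @ (e, \<not> b) # L2) = ?p \<otimes> signed_prod G y ((e, \<not> b) # L2)"
      by (rule signed_prod_append) (use less.prems(2) L NC in auto)
    also have "signed_prod G y ((e, \<not> b) # L2) = inv z \<otimes> ?q"
      using c by (auto simp: z_def)
    also have "z \<otimes> (?p \<otimes> (inv z \<otimes> ?q)) = (z \<otimes> ?p \<otimes> inv z \<otimes> inv ?p) \<otimes> (?p \<otimes> ?q)"
    proof -
      have "inv ?p \<otimes> (?p \<otimes> ?q) = ?q" using c by (simp flip: m_assoc)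
      then show ?thesis using c by (simp add: m_assoc)
    qed
    also have "?p \<otimes> ?q = signed_prod G y (L1 @ L2)"
      by (rule signed_prod_append[symmetric]) (use yN NC in blast)
    finally have eq: "signed_prod G y L
        = (z \<otimes> ?p \<otimes> inv z \<otimes> inv ?p) \<otimes> signed_prod G y (L1 @ L2)" .
    have "z \<otimes> ?p \<otimes> inv z \<otimes> inv ?p \<in> derived G N"
      unfolding derived_def by (rule generate.incl) (use z pq in blast)
    moreover have "signed_prod G y (L1 @ L2) \<in> derived G N"
      using less.hyps[of "L1 @ L2"] bal yN L by simp
    ultimately show ?thesis using eq subgroup.m_closed[OF D] by metis
  qed
qed

subsection \<open>Integer sequences killed by iterated differences\<close>

text \<open>The integer-valued polynomials of degree less than \<open>n\<close>, described by their
  vanishing \<open>n\<close>-th difference, the form in which translation by \<open>h\<close> meets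
  them.\<close>

primrec diff_nil :: "nat \<Rightarrow> (int \<Rightarrow> int) \<Rightarrow> bool" where
  "diff_nil 0 p \<longleftrightarrow> p = (\<lambda>_. 0)"
| "diff_nil (Suc n) p \<longleftrightarrow> diff_nil n (\<lambda>k. p (k + 1) - p k)"

lemma diff_nil_add: "diff_nil n p \<Longrightarrow> diff_nil n q \<Longrightarrow> diff_nil n (\<lambda>k. p k + q k)"
proof (induction n arbitrary: p q)
  case (Suc n)
  have "diff_nil n (\<lambda>k. (p (k + 1) - p k) + (q (k + 1) - q k))"
    using Suc by auto
  then show ?case by (simp add: algebra_simps)
qed auto

lemma diff_nil_shift: "diff_nil n p \<Longrightarrow> diff_nil n (\<lambda>k. p (k + 1))"
proof (induction n arbitrary: p)
  case (Suc n)
  show ?case using Suc.IH[of "\<lambda>k. p (k + 1) - p k"] Suc.prems by simp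
qed auto

text \<open>Product rule: the difference of \<open>(k - j) * p k\<close> is \<open>(k - j)\<close>
  times the difference of \<open>p\<close>, plus \<open>p (k + 1)\<close>.\<close>

lemma diff_nil_linear_mult: "diff_nil n p \<Longrightarrow> diff_nil (Suc n) (\<lambda>k. (k - j) * p k)"
proof (induction n arbitrary: p)
  case (Suc n)
  have "diff_nil (Suc n) (\<lambda>k. (k - j) * (p (k + 1) - p k) + p (k + 1))"
    by (rule diff_nil_add[OF Suc.IH diff_nil_shift[OF Suc.prems]]) (use Suc.prems in simp)
  moreover have "(\<lambda>k. (k - j) * (p (k + 1) - p k) + p (k + 1))
      = (\<lambda>k. (k + 1 - j) * p (k + 1) - (k - j) * p k)"
    by (auto simp: algebra_simps)
  ultimately show ?case by simp
qed auto

text \<open>The witness is the product of the factors \<open>k - j\<close> over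
  \<open>j \<in> J\<close>; it is nonzero at 0 because \<open>0 \<notin> J\<close>.\<close>

lemma diff_nil_separating:
  assumes "finite J" "0 \<notin> J"
  shows "\<exists>n p. diff_nil n p \<and> p 0 \<noteq> 0 \<and> (\<forall>j\<in>J. p j = 0)"
  using assms
proof (induction J)
  case empty
  have "diff_nil 1 (\<lambda>_. 1)" by simp
  then show ?case by fastforce
next
  case (insert j J)
  then obtain n p where p: "diff_nil n p" "p 0 \<noteq> 0" "\<forall>j\<in>J. p j = 0" by auto
  have "diff_nil (Suc n) (\<lambda>k. (k - j) * p k)" using diff_nil_linear_mult[OF p(1)] .
  then show ?case using p insert.prems by (intro exI[of _ "Suc n"] exI[of _ "\<lambda>k. (k - j) * p k"]) auto
qed

subsection \<open>Paths in the Cayley graph of a quotient of a free group\<close>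

text \<open>The pairing of an integer function on the edges with the flow of a path.\<close>

definition esum :: "('e \<Rightarrow> int) \<Rightarrow> ('e \<times> bool) list \<Rightarrow> int" where
  "esum \<phi> L = (\<Sum>(e, b)\<leftarrow>L. if b then - \<phi> e else \<phi> e)"

lemma esum_simps [simp]:
  "esum \<phi> [] = 0"
  "esum \<phi> ((e, b) # L) = (if b then - \<phi> e else \<phi> e) + esum \<phi> L"
  by (auto simp: esum_def)

lemma esum_add: "esum (\<lambda>e. \<phi> e + \<psi> e) L = esum \<phi> L + esum \<psi> L"
  by (induction L) auto

lemma esum_map: "esum \<phi> (map (\<lambda>(e, b). (f e, b)) L) = esum (\<lambda>e. \<phi> (f e)) L"
  by (induction L) auto

lemma esum_cong: "(\<And>e b. (e, b) \<in> set L \<Longrightarrow> \<phi> e = \<psi> e) \<Longrightarrow> esum \<phi> L = esum \<psi> L"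
proof (induction L)
  case (Cons a L)
  obtain e b where a: "a = (e, b)" by (cases a)
  have "\<phi> e = \<psi> e" "esum \<phi> L = esum \<psi> L" using Cons a by auto
  then show ?case using a by simp
qed auto

text \<open>A function that vanishes on all other edges of the path reads off the net flow through
  \<open>e\<close>.\<close>

lemma esum_point:
  assumes "\<And>e' b. (e', b) \<in> set L \<Longrightarrow> e' \<noteq> e \<Longrightarrow> \<phi> e' = 0"
  shows "esum \<phi> L = \<phi> e * (int (count_list L (e, False)) - int (count_list L (e, True)))"
  using assms
proof (induction L)
  case (Cons a L)
  obtain e' b where a: "a = (e', b)" by (cases a)
  have IH: "esum \<phi> L = \<phi> e * (int (count_list L (e, False)) - int (count_list L (e, True)))"
    using Cons by auto
  have "e' \<noteq> e \<Longrightarrow> \<phi> e' = 0" using Cons.prems a by auto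
  then show ?case using a IH by (cases "e' = e"; cases b) (auto simp: algebra_simps)
qed auto

locale free_group_quotient = normal N F
  for N :: "('a \<times> bool) list set" and F :: "('a \<times> bool) list monoid" (structure) +
  fixes S :: "'a set"
  assumes F_eq: "F = free_group_on S"
begin

lemma one_eq: "\<one> = []"
  by (simp add: F_eq free_group_on_def)

lemma mult_eq: "u \<otimes> v = foldr push_letter u v"
  by (simp add: F_eq free_group_on_def)

lemma carrier_iff: "w \<in> carrier F \<longleftrightarrow> reduced_word w \<and> fst ` set w \<subseteq> S"
  by (simp add: F_eq free_group_on_def)

lemma letter_closed: "fst l \<in> S \<Longrightarrow> [l] \<in> carrier F"
  by (simp add: carrier_iff)

lemma letter_inverse: "fst l \<in> S \<Longrightarrow> [inv_letter l] \<otimes> [l] = \<one>"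
  by (cases l) (simp add: mult_eq one_eq)

lemma inv_letter: "fst l \<in> S \<Longrightarrow> inv [l] = [inv_letter l]"
  using letter_inverse[of l] by (intro inv_equality letter_closed) auto

lemma Cons_carrierD: "l # w \<in> carrier F \<Longrightarrow> fst l \<in> S \<and> w \<in> carrier F \<and> l # w = [l] \<otimes> w"
  using reduced_word_tl[of l w] push_letter_reduced[of l w] by (auto simp: carrier_iff mult_eq)

lemma carrier_induct [consumes 1, case_names Nil Cons]:
  assumes "w \<in> carrier F" and "P []"
    and "\<And>l w. fst l \<in> S \<Longrightarrow> w \<in> carrier F \<Longrightarrow> l # w = [l] \<otimes> w \<Longrightarrow> P w \<Longrightarrow> P (l # w)"
  shows "P w"
  using assms(1)
proof (induction w)
  case (Cons l w)
  then show ?case using Cons_carrierD[of l w] assms(3) by blast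
qed (rule assms(2))

text \<open>Edges of the Cayley graph of the quotient by \<open>N\<close> are pairs of a coset and a generator;
  a letter with flag \<open>True\<close> traverses its edge backwards.\<close>

primrec edges :: "('a \<times> bool) list \<Rightarrow> ('a \<times> bool) list
    \<Rightarrow> ((('a \<times> bool) list set \<times> 'a) \<times> bool) list" where
  "edges v [] = []"
| "edges v (l # w) = ((N #> (if snd l then v \<otimes> [l] else v), fst l), snd l) # edges (v \<otimes> [l]) w"

text \<open>The value of the functional \<open>\<phi>\<close> on the path that starts at the vertex
  \<open>N #> v\<close> and spells \<open>w\<close>.\<close>

definition psum where "psum \<phi> v w = esum \<phi> (edges v w)"

lemma psum_Nil [simp]: "psum \<phi> v [] = 0"
  by (simp add: psum_def)

lemma psum_Cons: "psum \<phi> v (l # w) = psum \<phi> v [l] + psum \<phi> (v \<otimes> [l]) w"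
  by (simp add: psum_def)

lemma edges_cosets:
  "w \<in> carrier F \<Longrightarrow> v \<in> carrier F \<Longrightarrow> ((C, x), b) \<in> set (edges v w) \<Longrightarrow>
     x \<in> S \<and> (\<exists>u \<in> carrier F. C = N #> u)"
proof (induction w arbitrary: v rule: carrier_induct)
  case (Cons l w)
  have "v \<otimes> [l] \<in> carrier F" using Cons letter_closed by simp
  then show ?case using Cons.IH Cons.prems Cons.hyps(1,2) by (auto split: if_splits)
qed simp

text \<open>A cancelling pair of letters runs through one edge in both directions and contributes
  zero, so free reduction does not change the value.\<close>

lemma psum_push_letter:
  assumes v: "v \<in> carrier F" and l: "fst l \<in> S" and w: "w \<in> carrier F"
  shows "psum \<phi> v (push_letter l w) = psum \<phi> v [l] + psum \<phi> (v \<otimes> [l]) w"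
proof (cases "\<exists>ys. w = inv_letter l # ys")
  case True
  then obtain ys where ys: "w = inv_letter l # ys" by blast
  have "v \<otimes> [l] \<otimes> [inv_letter l] = v"
    using v l letter_closed[of l] inv_letter[OF l] by (simp add: m_assoc flip: inv_letter)
  then show ?thesis
    using ys by (cases l) (auto simp: psum_def)
next
  case False
  then have "push_letter l w = l # w"
    using cancel_iff[of l] by (cases w) auto
  then show ?thesis using psum_Cons by metis
qed

lemma psum_mult:
  assumes "u \<in> carrier F" "v \<in> carrier F" "w \<in> carrier F"
  shows "psum \<phi> v (u \<otimes> w) = psum \<phi> v u + psum \<phi> (v \<otimes> u) w"
  using assms
proof (induction u arbitrary: v rule: carrier_induct)
  case Nil
  then show ?case by (simp flip: one_eq) (simp add: one_eq)
next
  case (Cons l u)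
  have vl: "v \<otimes> [l] \<in> carrier F" using Cons letter_closed by simp
  have "(l # u) \<otimes> w = push_letter l (u \<otimes> w)" by (simp add: mult_eq)
  moreover have "u \<otimes> w \<in> carrier F" using Cons by simp
  ultimately have "psum \<phi> v ((l # u) \<otimes> w) = psum \<phi> v [l] + psum \<phi> (v \<otimes> [l]) (u \<otimes> w)"
    using psum_push_letter Cons by simp
  also have "\<dots> = psum \<phi> v [l] + (psum \<phi> (v \<otimes> [l]) u + psum \<phi> (v \<otimes> [l] \<otimes> u) w)"
    using Cons vl by simp
  also have "v \<otimes> [l] \<otimes> u = v \<otimes> (l # u)"
    using Cons letter_closed by (metis m_assoc)
  finally show ?case by (simp add: psum_Cons[of \<phi> v l u])
qed

section \<open>Change of starting vertex, left translation, and closed paths\<close>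

lemma edges_coset_cong:
  assumes "w \<in> carrier F" "v \<in> carrier F" "v' \<in> carrier F" "N #> v = N #> v'"
  shows "edges v w = edges v' w"
  using assms
proof (induction w arbitrary: v v' rule: carrier_induct)
  case (Cons l w)
  have "N #> (v \<otimes> [l]) = N #> (v' \<otimes> [l])"
    using Cons letter_closed coset_mult_assoc[OF subset] by metis
  then show ?case using Cons.IH Cons.prems Cons.hyps(1,2) letter_closed by simp
qed simp

lemma lcos_coset:
  assumes "h \<in> carrier F" "v \<in> carrier F"
  shows "h <# (N #> v) = N #> (h \<otimes> v)"
proof -
  have "h <# (N #> v) = (h <# N) #> v" using rcos_assoc_lcos assms subset
    by (metis coset_assoc)
  also have "h <# N = N #> h" using coset_eq assms by simp
  finally show ?thesis using coset_mult_assoc[OF subset] assms by simp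
qed

text \<open>Letters act on vertices from the right, so left multiplication by \<open>h\<close> is an
  automorphism of the labelled Cayley graph.\<close>

lemma edges_translate:
  assumes "w \<in> carrier F" "h \<in> carrier F" "v \<in> carrier F"
  shows "edges (h \<otimes> v) w = map (\<lambda>(e, b). ((h <# fst e, snd e), b)) (edges v w)"
  using assms
proof (induction w arbitrary: v rule: carrier_induct)
  case (Cons l w)
  have vl: "v \<otimes> [l] \<in> carrier F" "h \<otimes> v \<otimes> [l] = h \<otimes> (v \<otimes> [l])"
    using Cons letter_closed by (simp_all add: m_assoc)
  then show ?case using Cons.IH Cons.prems Cons.hyps(1,2) lcos_coset by simp
qed simp

lemma psum_translate:
  assumes "w \<in> carrier F" "h \<in> carrier F" "v \<in> carrier F"
  shows "psum \<phi> (h \<otimes> v) w = psum (\<lambda>e. \<phi> (h <# fst e, snd e)) v w"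
  using edges_translate[OF assms] by (simp add: psum_def esum_map)

text \<open>The path of \<open>m \<in> N\<close> closes up at the base vertex, so the path of
  \<open>n\<close> starts there again.\<close>

lemma psum_mult_normal:
  assumes "m \<in> N" "n \<in> N"
  shows "psum \<phi> \<one> (m \<otimes> n) = psum \<phi> \<one> m + psum \<phi> \<one> n"
proof -
  have "N #> (\<one> \<otimes> m) = N #> \<one>"
    using assms rcos_const[OF is_group] subset by auto
  then show ?thesis
    using psum_mult[of m \<one> n \<phi>] assms edges_coset_cong[of n "\<one> \<otimes> m" \<one>] by (simp add: psum_def)
qed

text \<open>The path of the conjugate runs along \<open>h\<close>, around the loop of
  \<open>n\<close> translated by \<open>h\<close>, and back; the two outer legs cancel.\<close>

lemma psum_conj:
  assumes h: "h \<in> carrier F" and n: "n \<in> N"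
  shows "psum \<phi> \<one> (h \<otimes> n \<otimes> inv h) = psum (\<lambda>e. \<phi> (h <# fst e, snd e)) \<one> n"
proof -
  have nc: "n \<in> carrier F" using n by simp
  have hn: "h \<otimes> n = (h \<otimes> n \<otimes> inv h) \<otimes> h"
    using h nc by (simp add: m_assoc)
  have hnh: "h \<otimes> n \<otimes> inv h \<in> N" using h n inv_op_closed2 by blast
  have cos: "N #> (h \<otimes> n) = N #> h"
    using h hnh hn rcos_const[OF is_group hnh] coset_mult_assoc[OF subset, of "h \<otimes> n \<otimes> inv h" h] nc
    by (metis inv_closed m_closed)
  have "psum \<phi> \<one> (h \<otimes> inv h) = psum \<phi> \<one> h + psum \<phi> h (inv h)"
    using psum_mult[of h \<one> "inv h" \<phi>] h by simp
  then have 0: "psum \<phi> \<one> h + psum \<phi> h (inv h) = 0" using h one_eq by simp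
  have "psum \<phi> \<one> (h \<otimes> n \<otimes> inv h) = psum \<phi> \<one> (h \<otimes> n) + psum \<phi> (h \<otimes> n) (inv h)"
    using psum_mult[of "h \<otimes> n" \<one> "inv h" \<phi>] h nc by simp
  also have "psum \<phi> \<one> (h \<otimes> n) = psum \<phi> \<one> h + psum \<phi> h n"
    using psum_mult[of h \<one> n \<phi>] h nc by simp
  also have "psum \<phi> (h \<otimes> n) (inv h) = psum \<phi> h (inv h)"
    using edges_coset_cong[of "inv h" "h \<otimes> n" h] cos h nc by (simp add: psum_def)
  finally have "psum \<phi> \<one> (h \<otimes> n \<otimes> inv h) = psum \<phi> h n" using 0 by simp
  then show ?thesis using psum_translate[of n h \<one> \<phi>] h nc by simp
qed

section \<open>Schreier generators and the rewriting process\<close>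

lemma coset_eqD:
  assumes "u \<in> carrier F" "v \<in> carrier F" "N #> u = N #> v"
  shows "u \<otimes> inv v \<in> N"
proof -
  have "N #> (u \<otimes> inv v) = N"
    using assms coset_mult_inv1[of N u v] coset_mult_inv2[of N u v] subset by auto
  then show ?thesis using assms coset_join1[OF _ _ is_subgroup] by simp
qed

text \<open>A transversal of the cosets of \<open>N\<close>. It is normalised to represent
  \<open>N\<close> by the identity, so that no correction factors remain for closed paths at the
  base vertex.\<close>

definition section_map :: "('a \<times> bool) list set \<Rightarrow> ('a \<times> bool) list" where
  "section_map C = (if C = N then \<one> else SOME v. v \<in> C)"

lemma section_map_coset:
  assumes "v \<in> carrier F"
  shows "section_map (N #> v) \<in> N #> v"
proof (cases "N #> v = N")
  case True
  then show ?thesis by (simp add: section_map_def)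
next
  case False
  have "v \<in> N #> v" using assms rcos_self is_subgroup by simp
  then show ?thesis using False by (simp add: section_map_def) (metis someI)
qed

lemma section_map_closed: "v \<in> carrier F \<Longrightarrow> section_map (N #> v) \<in> carrier F"
  using section_map_coset r_coset_subset_G[OF subset] by blast

lemma N_section_map: "v \<in> carrier F \<Longrightarrow> N #> section_map (N #> v) = N #> v"
  using section_map_coset repr_independence is_subgroup by metis

text \<open>The Schreier generator of \<open>N\<close> that belongs to an edge.\<close>

definition edge_elem where
  "edge_elem e = section_map (fst e) \<otimes> [(snd e, False)] \<otimes> inv section_map (fst e #> [(snd e, False)])"

lemma edge_elem_coset:
  assumes "v \<in> carrier F" "x \<in> S"
  shows "edge_elem (N #> v, x)
    = section_map (N #> v) \<otimes> [(x, False)] \<otimes> inv section_map (N #> (v \<otimes> [(x, False)]))"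
  using assms coset_mult_assoc[OF subset, of v "[(x, False)]"] letter_closed[of "(x, False)"]
  by (simp add: edge_elem_def)

lemma edge_elem_normal:
  assumes "v \<in> carrier F" "x \<in> S"
  shows "edge_elem (N #> v, x) \<in> N"
proof -
  let ?x = "[(x, False)]"
  let ?s = "section_map (N #> v)" and ?t = "section_map (N #> (v \<otimes> ?x))"
  have x: "?x \<in> carrier F" using assms letter_closed by simp
  have c: "?s \<in> carrier F" "?t \<in> carrier F" using assms x section_map_closed by auto
  have "N #> (?s \<otimes> ?x) = N #> ?t"
    using assms x c N_section_map coset_mult_assoc[OF subset] by (metis m_closed)
  then have "?s \<otimes> ?x \<otimes> inv ?t \<in> N"
    using c x by (intro coset_eqD) auto
  then show ?thesis using edge_elem_coset[OF assms] by simp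
qed

text \<open>Reidemeister-Schreier rewriting: every letter contributes the representative of its
  start, the letter, and the inverse representative of its end, and these products
  telescope.\<close>

lemma signed_prod_edges:
  assumes "w \<in> carrier F" "v \<in> carrier F"
  shows "signed_prod F edge_elem (edges v w)
    = section_map (N #> v) \<otimes> w \<otimes> inv section_map (N #> (v \<otimes> w))"
  using assms
proof (induction w arbitrary: v rule: carrier_induct)
  case Nil
  then have "section_map (N #> v) \<otimes> \<one> \<otimes> inv section_map (N #> (v \<otimes> \<one>)) = \<one>"
    using section_map_closed by simp
  then show ?case by (simp add: one_eq)
next
  case (Cons l w)
  have l: "[l] \<in> carrier F" "v \<otimes> [l] \<in> carrier F" using Cons letter_closed by auto
  let ?s = "section_map (N #> v)" and ?t = "section_map (N #> (v \<otimes> [l]))"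
    and ?u = "section_map (N #> (v \<otimes> [l] \<otimes> w))"
  have c: "?s \<in> carrier F" "?t \<in> carrier F" "?u \<in> carrier F"
    using Cons l section_map_closed by auto
  obtain x b where x: "l = (x, b)" by (cases l)
  \<comment> \<open>For an inverse letter the edge starts at the end point
    \<open>v \<otimes> [l]\<close>, so the inverse of its generator is the factor needed.\<close>
  have step: "(if b then inv (edge_elem (N #> (v \<otimes> [l]), x)) else edge_elem (N #> v, x))
      = ?s \<otimes> [l] \<otimes> inv ?t"
  proof (cases b)
    case True
    have y: "[(x, False)] = inv [l]" using inv_letter[of l] Cons x True by simp
    have "v \<otimes> [l] \<otimes> [(x, False)] = v" using y l Cons by (simp add: m_assoc)
    then have "edge_elem (N #> (v \<otimes> [l]), x) = ?t \<otimes> inv [l] \<otimes> inv ?s"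
      using edge_elem_coset[of "v \<otimes> [l]" x] l Cons x y by simp
    then show ?thesis using True c l by (simp add: inv_mult_group m_assoc)
  next
    case False
    then show ?thesis using edge_elem_coset[of v x] Cons x by simp
  qed
  have "signed_prod F edge_elem (edges v (l # w)) = ?s \<otimes> [l] \<otimes> inv ?t \<otimes> (?t \<otimes> w \<otimes> inv ?u)"
    using Cons.IH[OF l(2)] step x by (cases b) auto
  also have "\<dots> = ?s \<otimes> ([l] \<otimes> w) \<otimes> inv ?u"
  proof -
    have "inv ?t \<otimes> (?t \<otimes> (w \<otimes> inv ?u)) = w \<otimes> inv ?u"
      using c Cons.hyps(2) by (simp flip: m_assoc)
    then show ?thesis using c l Cons.hyps(2) by (simp add: m_assoc)
  qed
  also have "v \<otimes> [l] \<otimes> w = v \<otimes> ([l] \<otimes> w)" using l Cons by (simp add: m_assoc)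
  finally show ?case using Cons.hyps(3) by simp
qed

text \<open>Since \<open>w \<in> N\<close>, its path begins and ends at the base vertex, and the
  product of Schreier generators along it is \<open>w\<close> itself. This is the direction of the
  Magnus criterion that the argument uses.\<close>

lemma balanced_edges_imp_derived:
  assumes "w \<in> N" "balanced (edges \<one> w)"
  shows "w \<in> derived F N"
proof -
  have w: "w \<in> carrier F" using assms by simp
  have "edge_elem e \<in> N" if "(e, b) \<in> set (edges \<one> w)" for e b
    using edges_cosets[OF w one_closed, of "fst e" "snd e" b] that edge_elem_normal
    by (metis prod.collapse)
  then have "signed_prod F edge_elem (edges \<one> w) \<in> derived F N"
    using balanced_signed_prod[OF is_subgroup assms(2)] by blast
  moreover have "N #> w = N" "N #> \<one> = N"
    using assms(1) rcos_const[OF is_group] subset by auto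
  ultimately show ?thesis
    using signed_prod_edges[OF w one_closed] w by (simp add: section_map_def)
qed

end

subsection \<open>Functionals supported on one orbit of edges\<close>

context free_group_quotient
begin

text \<open>The functional with value \<open>p k\<close> on the \<open>k\<close>-th
  \<open>h\<close>-translate of the edge \<open>(N #> v, x)\<close> and zero on all other edges. The
  \<open>THE\<close> is well determined once no nontrivial power of \<open>h\<close> lies in
  \<open>N\<close>; see \<open>orbit_unique\<close>.\<close>

definition orbit_fun where
  "orbit_fun h v x p e =
     (if snd e = x \<and> (\<exists>k::int. fst e = N #> (h [^] k \<otimes> v))
      then p (THE k::int. fst e = N #> (h [^] k \<otimes> v)) else (0::int))"

lemma orbit_unique:
  assumes h: "h \<in> carrier F" and v: "v \<in> carrier F"
    and free: "\<And>k::int. h [^] k \<in> N \<Longrightarrow> k = 0"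
    and eq: "N #> (h [^] k \<otimes> v) = N #> (h [^] l \<otimes> v)"
  shows "k = (l::int)"
proof -
  have "(h [^] k \<otimes> v) \<otimes> inv (h [^] l \<otimes> v) \<in> N"
    using coset_eqD[OF _ _ eq] h v by simp
  also have "(h [^] k \<otimes> v) \<otimes> inv (h [^] l \<otimes> v) = h [^] k \<otimes> (v \<otimes> inv v) \<otimes> inv (h [^] l)"
    using h v by (simp only: inv_mult_group m_assoc m_closed int_pow_closed inv_closed)
  also have "\<dots> = h [^] (k - l)" using h v by (simp add: int_pow_diff)
  finally show ?thesis using free[of "k - l"] by simp
qed

context
  fixes h v :: "('a \<times> bool) list"
  assumes h: "h \<in> carrier F" and v: "v \<in> carrier F"
    and free: "\<And>k::int. h [^] k \<in> N \<Longrightarrow> k = 0"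
begin

lemma orbit_fun_orbit: "orbit_fun h v x p (N #> (h [^] (k::int) \<otimes> v), x) = p k"
proof -
  have "(THE l::int. N #> (h [^] k \<otimes> v) = N #> (h [^] l \<otimes> v)) = k"
    using orbit_unique[OF h v free] by (intro the_equality) blast+
  then show ?thesis unfolding orbit_fun_def by auto
qed

lemma orbit_fun_off:
  "\<not> (y = x \<and> (\<exists>k::int. C = N #> (h [^] k \<otimes> v))) \<Longrightarrow> orbit_fun h v x p (C, y) = 0"
  by (auto simp: orbit_fun_def)

lemma lcos_orbit: "h <# (N #> (h [^] (k::int) \<otimes> v)) = N #> (h [^] (k + 1) \<otimes> v)"
proof -
  have "h \<otimes> (h [^] k \<otimes> v) = h [^] (1 + k) \<otimes> v"
    using h v by (simp add: int_pow_mult m_assoc)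
  then show ?thesis using lcos_coset h v by (simp add: add.commute)
qed

text \<open>Translation by \<open>h\<close> moves the index from \<open>k\<close> to
  \<open>k + 1\<close>, which adds the difference of \<open>p\<close>. Off the orbit all terms are
  zero, since the orbit is also closed under the inverse of \<open>h\<close>.\<close>

lemma orbit_fun_translate:
  assumes u: "u \<in> carrier F"
  shows "orbit_fun h v x p (h <# (N #> u), y)
    = orbit_fun h v x p (N #> u, y) + orbit_fun h v x (\<lambda>k. p (k + 1) - p k) (N #> u, y)"
proof (cases "y = x \<and> (\<exists>k::int. N #> u = N #> (h [^] k \<otimes> v))")
  case True
  then obtain k where k: "y = x" "N #> u = N #> (h [^] (k::int) \<otimes> v)" by blast
  show ?thesis unfolding k lcos_orbit orbit_fun_orbit by simp
next
  case False
  have "\<not> (y = x \<and> (\<exists>k::int. h <# (N #> u) = N #> (h [^] k \<otimes> v)))"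
  proof
    assume "y = x \<and> (\<exists>k::int. h <# (N #> u) = N #> (h [^] k \<otimes> v))"
    then obtain k where k: "y = x" "h <# (N #> u) = N #> (h [^] (k::int) \<otimes> v)" by blast
    have "h <# (N #> u) = h <# (N #> (h [^] (k - 1) \<otimes> v))"
      using k(2) lcos_orbit[of "k - 1"] by simp
    then have "inv h <# (h <# (N #> u)) = inv h <# (h <# (N #> (h [^] (k - 1) \<otimes> v)))"
      by simp
    moreover have "inv h <# (h <# (N #> w)) = N #> w" if "w \<in> carrier F" for w
      using that h lcos_coset by (simp flip: m_assoc)
    ultimately have "N #> u = N #> (h [^] (k - 1) \<otimes> v)" using u h v by simp
    then show False using False k(1) by blast
  qed
  then show ?thesis using False by (simp add: orbit_fun_off)
qed

text \<open>Induction on the number of differences needed to kill \<open>p\<close>: conjugation by \<open>h\<close> changes the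
  functional of \<open>p\<close> by that of its difference, so it is invariant under \<open>h\<close> by the induction
  hypothesis and therefore vanishes on the commutators of \<open>K\<close>.\<close>

lemma orbit_psum_zero:
  assumes P: "subgroup P F" "P \<subseteq> N"
    and conj: "\<And>p. p \<in> P \<Longrightarrow> h \<otimes> p \<otimes> inv h \<in> P" "\<And>p. p \<in> P \<Longrightarrow> inv h \<otimes> p \<otimes> h \<in> P"
    and K: "\<And>a. a \<in> K \<Longrightarrow> \<exists>p \<in> P. \<exists>k::int. a = p \<otimes> h [^] k"
    and gen: "\<And>w. w \<in> P \<Longrightarrow> \<exists>c \<in> derived F K. \<exists>z \<in> derived F N. w = c \<otimes> z"
  shows "diff_nil n p \<Longrightarrow> w \<in> P \<Longrightarrow> psum (orbit_fun h v x p) \<one> w = 0"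
proof (induction n arbitrary: p w)
  case 0
  then have "orbit_fun h v x p e = 0" for e by (simp add: orbit_fun_def)
  \<comment> \<open>The functional is zero, so any edge serves in \<open>esum_point\<close>;
    \<open>(N, x)\<close> is an arbitrary choice.\<close>
  then show ?case unfolding psum_def by (subst esum_point[of _ "(N, x)"]) auto
next
  case (Suc n)
  let ?f = "psum (orbit_fun h v x p) \<one>"
  have add: "?f (a \<otimes> b) = ?f a + ?f b" if "a \<in> N" "b \<in> N" for a b
    using psum_mult_normal that by blast
  have inv_f: "?f (h \<otimes> q \<otimes> inv h) = ?f q" if q: "q \<in> P" for q
  proof -
    have qN: "q \<in> N" "q \<in> carrier F" using q P(2) by auto
    have "?f (h \<otimes> q \<otimes> inv h) = psum (\<lambda>e. orbit_fun h v x p (h <# fst e, snd e)) \<one> q"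
      using psum_conj[OF h qN(1)] .
    also have "\<dots> = psum (\<lambda>e. orbit_fun h v x p e
        + orbit_fun h v x (\<lambda>k. p (k + 1) - p k) e) \<one> q"
      unfolding psum_def
    proof (rule esum_cong)
      fix e b assume e: "(e, b) \<in> set (edges \<one> q)"
      obtain C y where C: "e = (C, y)" by (cases e)
      then obtain u where "u \<in> carrier F" "C = N #> u"
        using edges_cosets[OF qN(2) one_closed, of C y b] e by auto
      then show "orbit_fun h v x p (h <# fst e, snd e)
          = orbit_fun h v x p e + orbit_fun h v x (\<lambda>k. p (k + 1) - p k) e"
        using orbit_fun_translate[of u x p y] C by simp
    qed
    also have "\<dots> = ?f q" using Suc.IH[of "\<lambda>k. p (k + 1) - p k" q] Suc.prems(1) q
      by (simp add: psum_def esum_add)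
    finally show ?thesis .
  qed
  obtain c z where cz: "c \<in> derived F K" "z \<in> derived F N" "w = c \<otimes> z"
    using gen[OF Suc.prems(2)] by blast
  have addP: "?f (a \<otimes> b) = ?f a + ?f b" if "a \<in> P" "b \<in> P" for a b
    using add that P(2) by blast
  have c: "c \<in> P \<and> ?f c = 0"
    by (rule conj_invariant_derived_zero[of P h ?f K, OF P(1) h addP _ conj(2) K cz(1)])
      (use conj(1) inv_f in blast)+
  have z: "?f z = 0"
    by (rule additive_derived_zero[of N ?f, OF is_subgroup add cz(2)])
  have "z \<in> N" using cz(2) derived_incl[OF order_refl is_subgroup] by blast
  then show ?case using add[of c z] c z P(2) cz(3) by auto
qed

end

text \<open>Each edge \<open>e\<close> on the path of \<open>w\<close> is isolated by a functional
  on its \<open>h\<close>-orbit: \<open>p\<close> is nonzero at index 0 and vanishes at every other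
  index whose edge lies on the path. As \<open>orbit_psum_zero\<close> kills this functional, the
  net flow through \<open>e\<close> is zero.\<close>

lemma subset_derived:
  assumes h: "h \<in> carrier F" and free: "\<And>k::int. h [^] k \<in> N \<Longrightarrow> k = 0"
    and P: "subgroup P F" "P \<subseteq> N"
    and conj: "\<And>p. p \<in> P \<Longrightarrow> h \<otimes> p \<otimes> inv h \<in> P" "\<And>p. p \<in> P \<Longrightarrow> inv h \<otimes> p \<otimes> h \<in> P"
    and K: "\<And>a. a \<in> K \<Longrightarrow> \<exists>p \<in> P. \<exists>k::int. a = p \<otimes> h [^] k"
    and gen: "\<And>w. w \<in> P \<Longrightarrow> \<exists>c \<in> derived F K. \<exists>z \<in> derived F N. w = c \<otimes> z"
  shows "P \<subseteq> derived F N"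
proof
  fix w assume w: "w \<in> P"
  then have wN: "w \<in> N" "w \<in> carrier F" using P(2) by auto
  let ?L = "edges \<one> w"
  have "count_list ?L (e, False) = count_list ?L (e, True)" for e
  proof (cases "\<exists>b. (e, b) \<in> set ?L")
    case False
    then show ?thesis by (simp add: count_list_0_iff)
  next
    case True
    obtain C x where e: "e = (C, x)" by (cases e)
    then obtain v where v: "v \<in> carrier F" "C = N #> v"
      using True edges_cosets[OF wN(2) one_closed] by blast
    define J where "J = {k::int. k \<noteq> 0 \<and> (N #> (h [^] k \<otimes> v), x) \<in> fst ` set ?L}"
    \<comment> \<open>Because \<open>h\<close> acts freely, distinct indices give distinct edges,
      and the path has only finitely many.\<close>
    have "inj_on (\<lambda>k::int. (N #> (h [^] k \<otimes> v), x)) J"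
      using orbit_unique[OF h v(1) free] by (auto intro: inj_onI)
    then have "finite J"
      by (rule inj_on_finite[of _ _ "fst ` set ?L"]) (auto simp: J_def)
    then obtain n p where p: "diff_nil n p" "p 0 \<noteq> 0" "\<forall>j\<in>J. p j = 0"
      using diff_nil_separating[of J] by (auto simp: J_def)
    let ?\<phi> = "orbit_fun h v x p"
    have e0: "e = (N #> (h [^] (0::int) \<otimes> v), x)" using e v by simp
    have off: "?\<phi> e' = 0" if e': "(e', b) \<in> set ?L" "e' \<noteq> e" for e' b
    proof (cases "snd e' = x \<and> (\<exists>k::int. fst e' = N #> (h [^] k \<otimes> v))")
      case True
      then obtain k where k: "e' = (N #> (h [^] (k::int) \<otimes> v), x)" by (metis prod.collapse)
      then have "k \<in> J" using e' e0 by (force simp: J_def)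
      then have "p k = 0" using p(3) by blast
      then show ?thesis unfolding k using orbit_fun_orbit[OF h v(1) free, of x p k] by simp
    next
      case False
      then show ?thesis using orbit_fun_off[OF h v(1) free] by (metis prod.collapse)
    qed
    have "0 = psum ?\<phi> \<one> w"
      using orbit_psum_zero[OF h v(1) free P conj K gen p(1) w] by simp
    also have "\<dots> = ?\<phi> e * (int (count_list ?L (e, False)) - int (count_list ?L (e, True)))"
      unfolding psum_def by (rule esum_point) (rule off)
    also have "?\<phi> e = p 0" unfolding e0 by (rule orbit_fun_orbit[OF h v(1) free])
    finally show ?thesis using p(2) by simp
  qed
  then show "w \<in> derived F N"
    using balanced_edges_imp_derived[OF wN(1)] by (simp add: balanced_def)
qed

end

subsection \<open>Exponent sums\<close>

locale free_group_carrier =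
  fixes F :: "('a \<times> bool) list monoid" (structure) and S :: "'a set"
  assumes F_def: "F = free_group_on S"
begin

sublocale group F
  unfolding F_def by (rule group_free_group_on)

sublocale whole: free_group_quotient "carrier F" F S
  using normal_self F_def by (simp add: free_group_quotient_def free_group_quotient_axioms_def)

text \<open>Modulo the whole group the Cayley graph has one vertex and one loop per generator, so
  the path functional becomes a weighted exponent sum.\<close>

definition exponent_sum :: "('a \<Rightarrow> int) \<Rightarrow> ('a \<times> bool) list \<Rightarrow> int" where
  "exponent_sum c w = whole.psum (\<lambda>e. c (snd e)) \<one> w"

lemma exponent_sum_mult:
  "u \<in> carrier F \<Longrightarrow> w \<in> carrier F \<Longrightarrow> exponent_sum c (u \<otimes> w) = exponent_sum c u + exponent_sum c w"
  unfolding exponent_sum_def by (rule whole.psum_mult_normal)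

lemma exponent_sum_letter [simp]: "exponent_sum c [(x, False)] = c x"
  by (simp add: exponent_sum_def whole.psum_def)

lemma exponent_sum_linear:
  "exponent_sum (\<lambda>x. a * c x + b * c' x) w = a * exponent_sum c w + b * exponent_sum c' w"
proof -
  have "esum (\<lambda>e. a * \<phi> e + b * \<psi> e) L = a * esum \<phi> L + b * esum \<psi> L"
    for \<phi> \<psi> :: "'e \<Rightarrow> int" and L
    by (induction L) (auto simp: algebra_simps)
  then show ?thesis by (simp add: exponent_sum_def whole.psum_def)
qed

lemma exponent_sum_hom: "group_hom F integer_group (exponent_sum c)"
  by (intro group_hom.intro group_hom_axioms.intro homI)
    (auto simp: exponent_sum_mult)

lemma exponent_sum_derived: "w \<in> derived F (carrier F) \<Longrightarrow> exponent_sum c w = 0"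
  using additive_derived_zero[OF subgroup_self, of "exponent_sum c"] exponent_sum_mult by blast

lemma exponent_sum_int_pow: "g \<in> carrier F \<Longrightarrow> exponent_sum c (g [^] (k::int)) = k * exponent_sum c g"
  using group_hom.hom_int_pow[OF exponent_sum_hom] by simp

lemma exponent_sum_inv: "g \<in> carrier F \<Longrightarrow> exponent_sum c (inv g) = - exponent_sum c g"
  using group_hom.hom_inv[OF exponent_sum_hom] by simp

text \<open>With a single vertex, balance of the path means that every generator has exponent sum
  zero.\<close>

lemma derived_if_exponent_sums_zero:
  assumes w: "w \<in> carrier F"
    and zero: "\<And>x. x \<in> S \<Longrightarrow> exponent_sum (\<lambda>y. if y = x then 1 else 0) w = 0"
  shows "w \<in> derived F (carrier F)"
proof -
  let ?L = "whole.edges \<one> w"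
  have L: "C = carrier F \<and> x \<in> S" if "((C, x), b) \<in> set ?L" for C x b
    using whole.edges_cosets[OF w one_closed that] coset_join2[OF _ subgroup_self] by auto
  have "count_list ?L (e, False) = count_list ?L (e, True)" for e
  proof (cases "\<exists>b. (e, b) \<in> set ?L")
    case False
    then show ?thesis by (simp add: count_list_0_iff)
  next
    case True
    obtain C x where e: "e = (C, x)" by (cases e)
    then have C: "C = carrier F" "x \<in> S" using True L by auto
    have "0 = esum (\<lambda>e'. if snd e' = x then 1 else 0) ?L"
      using zero[OF C(2)] by (simp add: exponent_sum_def whole.psum_def)
    also have "\<dots> = (if snd e = x then 1 else 0)
        * (int (count_list ?L (e, False)) - int (count_list ?L (e, True)))"
      by (rule esum_point) (use L e C in auto)
    finally show ?thesis using e by simp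
  qed
  then show ?thesis
    using whole.balanced_edges_imp_derived[OF w] by (simp add: balanced_def)
qed

lemma exponent_sums_realizable:
  fixes a :: "'a \<Rightarrow> int"
  assumes "finite T" "T \<subseteq> S"
  shows "\<exists>g \<in> carrier F. \<forall>x. exponent_sum (\<lambda>y. if y = x then 1 else 0) g = (if x \<in> T then a x else 0)"
  using assms
proof (induction T)
  case empty
  show ?case
    using exponent_sum_derived[OF subgroup.one_closed[OF derived_is_subgroup[OF order_refl]]]
    by (intro bexI[of _ \<one>]) auto
next
  case (insert t T)
  then obtain g where g: "g \<in> carrier F"
    "\<forall>x. exponent_sum (\<lambda>y. if y = x then 1 else 0) g = (if x \<in> T then a x else 0)" by auto
  have t: "[(t, False)] \<in> carrier F" using whole.letter_closed[of "(t, False)"] insert by simp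
  show ?case
    using g t insert.hyps(2)
    by (intro bexI[of _ "g \<otimes> [(t, False)] [^] a t"])
      (auto simp: exponent_sum_mult exponent_sum_int_pow)
qed

text \<open>Here \<open>m\<close> is the gcd of the exponent sums of \<open>h\<close>, obtained as
  the least positive value of \<open>exponent_sum c h\<close> over all weights \<open>c\<close>.
  Dividing the exponents of \<open>h\<close> by \<open>m\<close> gives those of
  \<open>g\<close>.\<close>

lemma power_mod_derived:
  assumes S: "finite S" and h: "h \<in> carrier F" "h \<notin> derived F (carrier F)"
  shows "\<exists>c m g. m > 0 \<and> exponent_sum c h = int m \<and> g \<in> carrier F
    \<and> h \<otimes> inv (g [^] m) \<in> derived F (carrier F)"
proof -
  let ?\<delta> = "\<lambda>x y. if y = x then 1 else (0::int)"
  define A where "A = {m. m > 0 \<and> (\<exists>c. exponent_sum c h = int m)}"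
  obtain x where x: "exponent_sum (?\<delta> x) h \<noteq> 0"
    using derived_if_exponent_sums_zero h by blast
  define s where "s = sgn (exponent_sum (?\<delta> x) h)"
  have "s * exponent_sum (?\<delta> x) h = \<bar>exponent_sum (?\<delta> x) h\<bar>"
    unfolding s_def by (metis abs_sgn mult.commute)
  \<comment> \<open>The sign \<open>s\<close> makes the value positive; the summand with coefficient
    0 only produces the shape of \<open>exponent_sum_linear\<close>.\<close>
  then have "exponent_sum (\<lambda>y. s * ?\<delta> x y + 0 * ?\<delta> x y) h = int (nat \<bar>exponent_sum (?\<delta> x) h\<bar>)"
    unfolding exponent_sum_linear by simp
  then have "nat \<bar>exponent_sum (?\<delta> x) h\<bar> \<in> A" using x unfolding A_def by auto
  define m where "m = (LEAST m. m \<in> A)"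
  have "m \<in> A" unfolding m_def by (rule LeastI) fact
  then obtain c where m: "m > 0" "exponent_sum c h = int m" by (auto simp: A_def)
  have least: "k \<in> A \<Longrightarrow> m \<le> k" for k unfolding m_def by (rule Least_le)
  \<comment> \<open>A nonzero remainder would itself be the value for the weights
    \<open>c' - q c\<close>, contradicting minimality of \<open>m\<close>.\<close>
  have dvd: "int m dvd exponent_sum c' h" for c'
  proof (rule ccontr)
    assume nd: "\<not> int m dvd exponent_sum c' h"
    let ?q = "exponent_sum c' h div int m" and ?r = "exponent_sum c' h mod int m"
    have "exponent_sum (\<lambda>y. 1 * c' y + (- ?q) * c y) h = ?r"
      unfolding exponent_sum_linear m(2) by (simp add: minus_div_mult_eq_mod)
    moreover have "?r < int m" "?r \<ge> 0" using m(1) by simp_all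
    moreover have "?r \<noteq> 0" using nd by (simp only: mod_eq_0_iff_dvd not_False_eq_True)
    ultimately have r: "exponent_sum (\<lambda>y. 1 * c' y + (- ?q) * c y) h = ?r" "?r > 0" "?r < int m"
      by linarith+
    then have "nat ?r > 0" "exponent_sum (\<lambda>y. 1 * c' y + (- ?q) * c y) h = int (nat ?r)"
      by simp_all
    then have "nat ?r \<in> A" unfolding A_def by blast
    then show False using least[of "nat ?r"] r(2,3) by linarith
  qed
  obtain g where g: "g \<in> carrier F"
    "\<forall>x. exponent_sum (?\<delta> x) g = (if x \<in> S then exponent_sum (?\<delta> x) h div int m else 0)"
    using exponent_sums_realizable[OF S order_refl, of "\<lambda>x. exponent_sum (?\<delta> x) h div int m"] by blast
  have "exponent_sum (?\<delta> x) (h \<otimes> inv (g [^] m)) = 0" if "x \<in> S" for x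
  proof -
    have "exponent_sum (?\<delta> x) (g [^] m) = int m * exponent_sum (?\<delta> x) g"
      using exponent_sum_int_pow[OF g(1), of _ "int m"] by (simp add: int_pow_int)
    then have "exponent_sum (?\<delta> x) (g [^] m) = exponent_sum (?\<delta> x) h"
      using g(2) that dvd by simp
    then show ?thesis using g(1) h(1) by (simp add: exponent_sum_mult exponent_sum_inv)
  qed
  then have "h \<otimes> inv (g [^] m) \<in> derived F (carrier F)"
    using derived_if_exponent_sums_zero g(1) h(1) by simp
  then show ?thesis using m g(1) by blast
qed

section \<open>The derived series of the free group\<close>

lemma exp_derived_normal: "(derived F ^^ n) (carrier F) \<lhd> F"
  by (induction n) (auto simp: normal_self derived_is_normal)

lemma exp_derived_antimono:
  "m \<le> n \<Longrightarrow> (derived F ^^ n) (carrier F) \<subseteq> (derived F ^^ m) (carrier F)"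
proof (induction n rule: dec_induct)
  case (step n)
  then show ?case
    using derived_incl[OF order_refl exp_of_derived_is_subgroup[OF subgroup_self]] by force
qed auto

text \<open>Climbs the derived series by \<open>subset_derived\<close>, one term at a time. The
  error \<open>z\<close> from \<open>gen\<close> lies in the \<open>d\<close>-th term, hence in the
  derived subgroup of the \<open>i\<close>-th term as long as \<open>i < d\<close>.\<close>

lemma inter_derived_subset_exp_derived:
  assumes K: "subgroup K F" and h: "h \<in> K"
    and free: "\<And>k::int. h [^] k \<in> derived F (carrier F) \<Longrightarrow> k = 0"
    and cyc: "\<And>a. a \<in> K \<Longrightarrow> \<exists>k::int. a \<otimes> inv (h [^] k) \<in> derived F (carrier F)"
    and gen: "\<And>w. w \<in> K \<Longrightarrow> w \<in> derived F (carrier F) \<Longrightarrow>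
      \<exists>c \<in> derived F K. \<exists>z \<in> (derived F ^^ d) (carrier F). w = c \<otimes> z"
  shows "K \<inter> derived F (carrier F) \<subseteq> (derived F ^^ d) (carrier F)"
proof -
  let ?D = "derived F (carrier F)"
  let ?P = "K \<inter> ?D"
  interpret D: normal ?D F by (rule derived_self_is_normal)
  have hc: "h \<in> carrier F" using h subgroup.mem_carrier[OF K] by blast
  have P: "subgroup ?P F" using subgroups_Inter_pair[OF K D.is_subgroup] .
  have Kconj: "h \<otimes> p \<otimes> inv h \<in> ?P" "inv h \<otimes> p \<otimes> h \<in> ?P" if "p \<in> ?P" for p
    using that D.inv_op_closed1[OF hc] D.inv_op_closed2[OF hc] h
    by (auto intro: subgroup.m_closed[OF K] subgroup.m_inv_closed[OF K])
  have KP: "\<exists>p \<in> ?P. \<exists>k::int. a = p \<otimes> h [^] k" if a: "a \<in> K" for a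
  proof -
    obtain k where k: "a \<otimes> inv (h [^] (k::int)) \<in> ?D" using cyc[OF a] by blast
    have "h [^] k \<in> K" using subgroup_int_pow_closed[OF K h] .
    then have "a \<otimes> inv (h [^] k) \<in> ?P"
      using a k by (auto intro: subgroup.m_closed[OF K] subgroup.m_inv_closed[OF K])
    moreover have "a = a \<otimes> inv (h [^] k) \<otimes> h [^] k"
      using hc subgroup.mem_carrier[OF K a] by (simp add: m_assoc)
    ultimately show ?thesis by blast
  qed
  have "i \<le> d \<Longrightarrow> ?P \<subseteq> (derived F ^^ i) (carrier F)" for i
  proof (induction i)
    case 0
    then show ?case using D.subset by auto
  next
    case (Suc i)
    let ?N = "(derived F ^^ i) (carrier F)"
    show ?case
    \<comment> \<open>For \<open>i = 0\<close> the claim holds by definition of \<open>?P\<close>.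
      The flow argument starts at \<open>i = 1\<close>, where powers of \<open>h\<close> are
      nontrivial modulo \<open>?N\<close>.\<close>
    proof (cases "i = 0")
      case False
      interpret N: free_group_quotient ?N F S
        using exp_derived_normal F_def
        by (simp add: free_group_quotient_def free_group_quotient_axioms_def)
      have "?N \<subseteq> ?D" using exp_derived_antimono[of 1 i] False by simp
      then have free': "k = 0" if "h [^] k \<in> ?N" for k :: int using free that by blast
      have "?P \<subseteq> derived F ?N"
      proof (rule N.subset_derived[OF hc free' P _ Kconj KP])
        show "?P \<subseteq> ?N" using Suc by simp
        show "\<exists>c \<in> derived F K. \<exists>z \<in> derived F ?N. w = c \<otimes> z" if "w \<in> ?P" for w
          using gen[of w] that exp_derived_antimono[OF Suc.prems] by auto
      qed
      then show ?thesis by simp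
    qed auto
  qed
  then show ?thesis by blast
qed

end

subsection \<open>Verbally closed subgroups\<close>

lemma word_eval_simps [simp]:
  "word_eval G [] a = \<one>\<^bsub>G\<^esub>"
  "word_eval G ((i, b) # w) a = (if b then inv\<^bsub>G\<^esub> (a i) else a i) \<otimes>\<^bsub>G\<^esub> word_eval G w a"
  by (simp_all add: word_eval_def)

lemma word_eval_rename: "word_eval G (map (\<lambda>(i, b). (f i, b)) w) a = word_eval G w (a \<circ> f)"
  by (induction w) auto

context group
begin

lemma word_eval_closed: "a \<in> UNIV \<rightarrow> carrier G \<Longrightarrow> word_eval G w a \<in> carrier G"
  by (induction w) (auto simp: Pi_iff)

lemma word_eval_append:
  assumes "a \<in> UNIV \<rightarrow> carrier G"
  shows "word_eval G (u @ w) a = word_eval G u a \<otimes> word_eval G w a"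
  using assms word_eval_closed[OF assms] by (induction u) (auto simp: m_assoc Pi_iff)

lemma word_eval_replicate:
  assumes "a \<in> UNIV \<rightarrow> carrier G"
  shows "word_eval G (replicate m (i, False)) a = a i [^] m"
proof (induction m)
  case (Suc m)
  then have "word_eval G (replicate (Suc m) (i, False)) a = a i \<otimes> a i [^] m" by simp
  also have "\<dots> = a i [^] Suc m" by (rule nat_pow_Suc2[symmetric]) (use assms in auto)
  finally show ?case .
qed simp

text \<open>An element of the derived subgroup is a product of commutators. The word records that
  product with fresh variables for each commutator, so substituting elements of \<open>H\<close>
  yields a product of commutators of \<open>H\<close>.\<close>

lemma derived_word:
  assumes H: "subgroup H G" and c: "c \<in> derived G (carrier G)"
  shows "\<exists>w a. a \<in> UNIV \<rightarrow> carrier G \<and> word_eval G w a = c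
    \<and> (\<forall>b \<in> UNIV \<rightarrow> H. word_eval G w b \<in> derived G H)"
proof -
  have DH: "subgroup (derived G H) G"
    using derived_is_subgroup[OF subgroup.subset[OF H]] .
  have comm: "\<exists>w a. a \<in> UNIV \<rightarrow> carrier G \<and> word_eval G w a = p \<otimes> q \<otimes> inv p \<otimes> inv q
      \<and> (\<forall>b \<in> UNIV \<rightarrow> H. word_eval G w b \<in> derived G H)"
    if pq: "p \<in> carrier G" "q \<in> carrier G" for p q
  proof -
    let ?w = "[(0, False), (1, False), (0, True), (1, True)]"
    have eval: "word_eval G ?w b = b 0 \<otimes> b 1 \<otimes> inv (b 0) \<otimes> inv (b 1)"
      if "b \<in> UNIV \<rightarrow> carrier G" for b
      using that by (simp add: Pi_iff m_assoc)
    have "word_eval G ?w b \<in> derived G H" if b: "b \<in> UNIV \<rightarrow> H" for b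
    proof -
      have "b \<in> UNIV \<rightarrow> carrier G" using b subgroup.subset[OF H] by blast
      moreover have "b 0 \<in> H" "b 1 \<in> H" using b by auto
      ultimately show ?thesis
        unfolding derived_def by (subst eval) (auto intro!: generate.incl)
    qed
    then show ?thesis
      using eval[of "\<lambda>i. if i = 0 then p else q"] pq
      by (intro exI[of _ ?w] exI[of _ "\<lambda>i. if i = 0 then p else q"]) auto
  qed
  show ?thesis
    using c unfolding derived_def[of G "carrier G"]
  proof (induction rule: generate.induct)
    case one
    show ?case
      using subgroup.one_closed[OF DH] by (intro exI[of _ "[]"] exI[of _ "\<lambda>_. \<one>"]) auto
  next
    case (incl c)
    then show ?case using comm by blast
  next
    case (inv c)
    then obtain p q where pq: "p \<in> carrier G" "q \<in> carrier G" "c = p \<otimes> q \<otimes> inv p \<otimes> inv q"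
      by blast
    have "inv c = q \<otimes> p \<otimes> inv q \<otimes> inv p" using pq by (simp add: inv_mult_group m_assoc)
    then show ?case using comm[OF pq(2,1)] by simp
  next
    case (eng c1 c2)
    from eng.IH(1) obtain w1 a1 where 1: "a1 \<in> UNIV \<rightarrow> carrier G" "word_eval G w1 a1 = c1"
      "\<forall>b \<in> UNIV \<rightarrow> H. word_eval G w1 b \<in> derived G H" by blast
    from eng.IH(2) obtain w2 a2 where 2: "a2 \<in> UNIV \<rightarrow> carrier G" "word_eval G w2 a2 = c2"
      "\<forall>b \<in> UNIV \<rightarrow> H. word_eval G w2 b \<in> derived G H" by blast
    \<comment> \<open>Even and odd indices keep the variables of the two words disjoint.\<close>
    let ?w = "map (\<lambda>(i, b). (2 * i, b)) w1 @ map (\<lambda>(i, b). (2 * i + 1, b)) w2"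
    let ?a = "\<lambda>i. if even i then a1 (i div 2) else a2 (i div 2)"
    have eval: "word_eval G ?w b
        = word_eval G w1 (b \<circ> (\<lambda>i. 2 * i)) \<otimes> word_eval G w2 (b \<circ> (\<lambda>i. 2 * i + 1))"
      if "b \<in> UNIV \<rightarrow> carrier G" for b
      using word_eval_append[OF that] by (simp only: word_eval_rename)
    have "word_eval G ?w b \<in> derived G H" if b: "b \<in> UNIV \<rightarrow> H" for b
    proof -
      have "b \<in> UNIV \<rightarrow> carrier G" using b subgroup.subset[OF H] by blast
      moreover have "b \<circ> (\<lambda>i. 2 * i) \<in> UNIV \<rightarrow> H" "b \<circ> (\<lambda>i. 2 * i + 1) \<in> UNIV \<rightarrow> H"
        using b by auto
      ultimately show ?thesis
        using 1(3) 2(3) subgroup.m_closed[OF DH] by (subst eval) blast+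
    qed
    moreover have a: "?a \<in> UNIV \<rightarrow> carrier G" using 1(1) 2(1) by (auto simp: Pi_iff)
    moreover have "word_eval G ?w ?a = c1 \<otimes> c2"
      unfolding eval[OF a] using 1(2) 2(2) by (simp add: comp_def)
    ultimately show ?case by blast
  qed
qed

text \<open>The equation consisting of an \<open>m\<close>-th power times the word of
  \<open>derived_word\<close> is solvable in \<open>G\<close>, hence in \<open>H\<close>. The case
  \<open>m = 0\<close> says that \<open>H\<close> meets the derived subgroup of \<open>G\<close> in
  its own derived subgroup.\<close>

lemma verbally_closed_power_commutator:
  assumes H: "subgroup H G" and vc: "verbally_closed G H"
    and h: "g [^] (m::nat) \<otimes> c \<in> H" and g: "g \<in> carrier G" and c: "c \<in> derived G (carrier G)"
  shows "\<exists>u \<in> H. \<exists>z \<in> derived G H. g [^] m \<otimes> c = u [^] m \<otimes> z"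
proof -
  obtain w a where w: "a \<in> UNIV \<rightarrow> carrier G" "word_eval G w a = c"
    "\<forall>b \<in> UNIV \<rightarrow> H. word_eval G w b \<in> derived G H"
    using derived_word[OF H c] by blast
  \<comment> \<open>Variable 0 is reserved for the base of the power; the variables of
    \<open>w\<close> are shifted up by one.\<close>
  let ?w = "replicate m (0, False) @ map (\<lambda>(i, b). (Suc i, b)) w"
  have eval: "word_eval G ?w b = b 0 [^] m \<otimes> word_eval G w (b \<circ> Suc)"
    if "b \<in> UNIV \<rightarrow> carrier G" for b
    using word_eval_append[OF that] word_eval_replicate[OF that] by (simp only: word_eval_rename)
  have a: "case_nat g a \<in> UNIV \<rightarrow> carrier G"
    using g w(1) by (auto simp: Pi_iff split: nat.split)
  have "word_eval G ?w (case_nat g a) = g [^] m \<otimes> c"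
    unfolding eval[OF a] using w(2) by (simp add: comp_def)
  then obtain b where b: "b \<in> UNIV \<rightarrow> H" "word_eval G ?w b = g [^] m \<otimes> c"
    using vc h a unfolding verbally_closed_def by blast
  have "b \<in> UNIV \<rightarrow> carrier G" using b subgroup.subset[OF H] by blast
  then have "g [^] m \<otimes> c = b 0 [^] m \<otimes> word_eval G w (b \<circ> Suc)"
    using b(2) eval by simp
  moreover have "b 0 \<in> H" "b \<circ> Suc \<in> UNIV \<rightarrow> H" using b(1) by auto
  ultimately show ?thesis using w(3) by blast
qed

end

subsection \<open>Subgroups with cyclic image in the abelianization\<close>

text \<open>The finite generating set \<open>A\<close> ensures that the \<open>LEAST\<close> is
  attained. A trivial group would be generated by the empty set, giving the value 0.\<close>

lemma min_generators_eq_1: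
  assumes "group K" "finite A" "A \<subseteq> carrier K" "generate K A = carrier K" "min_generators K = 1"
  shows "\<exists>a \<in> carrier K. generate K {a} = carrier K \<and> carrier K \<noteq> {\<one>\<^bsub>K\<^esub>}"
proof -
  let ?P = "\<lambda>n. \<exists>A. finite A \<and> card A = n \<and> A \<subseteq> carrier K \<and> generate K A = carrier K"
  have "?P (card A)" using assms by blast
  then have "?P (LEAST n. ?P n)" by (rule LeastI)
  then have "?P 1" using assms(5) unfolding min_generators_def by simp
  then obtain a where a: "{a} \<subseteq> carrier K" "generate K {a} = carrier K"
    by (metis card_1_singletonE)
  have "carrier K \<noteq> {\<one>\<^bsub>K\<^esub>}"
  proof
    assume "carrier K = {\<one>\<^bsub>K\<^esub>}"
    then have "?P 0" using group.generate_empty[OF assms(1)] by (intro exI[of _ "{}"]) auto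
    then have "(LEAST n. ?P n) \<le> 0" by (rule Least_le)
    then show False using assms(5) unfolding min_generators_def by simp
  qed
  then show ?thesis using a by blast
qed

lemma (in group) r_ab_eq_1:
  assumes H: "subgroup H G" and fg: "finitely_generated_subgroup G H" and r: "r_ab G H = 1"
  shows "\<exists>h \<in> H. h \<notin> derived G (carrier G)
    \<and> (\<forall>x \<in> H. \<exists>k::int. x \<otimes> inv (h [^] k) \<in> derived G (carrier G))"
proof -
  let ?D = "derived G (carrier G)"
  let ?Q = "G Mod ?D"
  let ?q = "\<lambda>x. ?D #> x"
  interpret D: normal ?D G by (rule derived_self_is_normal)
  interpret Q: group ?Q by (rule D.factorgroup_is_group)
  interpret q: group_hom G ?Q ?q
    using D.r_coset_hom_Mod by (simp add: group_hom_def group_hom_axioms_def)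
  have I: "subgroup (?q ` H) ?Q" using q.subgroup_img_is_subgroup[OF H] .
  let ?K = "subgroup_generated ?Q (?q ` H)"
  have K: "carrier ?K = ?q ` H" "?K = ?Q\<lparr>carrier := ?q ` H\<rparr>"
    using subgroup.carrier_subgroup_generated_subgroup[OF I]
    by (simp_all add: subgroup_generated_def)
  have gen: "generate ?K B = generate ?Q B" if "B \<subseteq> ?q ` H" for B
    unfolding K(2) using Q.generate_consistent[OF that I] .
  obtain A where A: "finite A" "A \<subseteq> carrier G" "H = generate G A"
    using fg unfolding finitely_generated_subgroup_def by blast
  have AH: "A \<subseteq> H" unfolding A(3) by (rule subsetI) (rule generate.incl)
  have "generate ?K (?q ` A) = carrier ?K"
    using gen[of "?q ` A"] AH q.generate_img[OF A(2)] A(3) K(1) by auto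
  moreover have "?q ` A \<subseteq> carrier ?K" using AH K(1) by blast
  ultimately obtain a where a0: "a \<in> carrier ?K" "generate ?K {a} = carrier ?K"
      "carrier ?K \<noteq> {\<one>\<^bsub>?K\<^esub>}"
    using min_generators_eq_1[OF Q.group_subgroup_generated finite_imageI[OF A(1)]]
      r[unfolded r_ab_def] by meson
  have a: "a \<in> ?q ` H" "generate ?Q {a} = ?q ` H" "?q ` H \<noteq> {\<one>\<^bsub>?Q\<^esub>}"
    using a0 gen[of "{a}"] unfolding K(1) one_subgroup_generated by simp_all
  then obtain h where h: "h \<in> H" "a = ?q h" by blast
  have hc: "h \<in> carrier G" using h subgroup.mem_carrier[OF H] by blast
  have cyc: "\<exists>k::int. x \<otimes> inv (h [^] k) \<in> ?D" if x: "x \<in> H" for x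
  proof -
    have xc: "x \<in> carrier G" using x subgroup.mem_carrier[OF H] by blast
    have "?q x \<in> generate ?Q {?q h}" using a(2) h(2) x by blast
    then obtain k where "?q x = ?q h [^]\<^bsub>?Q\<^esub> (k::int)"
      using Q.generate_pow[of "?q h"] hc by auto
    then have "?q x = ?q (h [^] k)" using q.hom_int_pow[OF hc] by simp
    then have "x \<in> ?D #> (h [^] k)" using rcos_self[OF xc D.is_subgroup] by simp
    then show ?thesis using D.rcos_module_imp[OF is_group] hc by blast
  qed
  have "h \<notin> ?D"
  proof
    assume "h \<in> ?D"
    then have "?q h = ?D" using D.rcos_const[OF is_group] by simp
    then have "a = \<one>\<^bsub>?Q\<^esub>" using h(2) by simp
    then show False using a(2,3) Q.generate_one by simp
  qed
  then show ?thesis using h(1) cyc by blast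
qed

section \<open>Construction of the retraction\<close>

theorem theorem1:
  fixes r d :: nat and H :: "(nat \<times> bool) list set set"
  assumes "r \<ge> 1" and "d \<ge> 1"
    and "subgroup H (free_solvable_group r d)"
    and "finitely_generated_subgroup (free_solvable_group r d) H"
    and "verbally_closed (free_solvable_group r d) H"
    and "r_ab (free_solvable_group r d) H = 1"
  shows "is_retract (free_solvable_group r d) H"
proof -
  define F where "F = free_group r"
  define R where "R = (derived F ^^ d) (carrier F)"
  define G where "G = free_solvable_group r d"
  define DF where "DF = derived F (carrier F)"
  define DG where "DG = derived G (carrier G)"
  have G_eq: "G = F Mod R" by (simp add: G_def free_solvable_group_def F_def R_def)
  interpret F: free_group_carrier F "{..<r}"
    by unfold_locales (simp add: F_def free_group_def)
  interpret R: normal R F unfolding R_def by (rule F.exp_derived_normal)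
  interpret G: group G unfolding G_eq by (rule R.factorgroup_is_group)
  define \<pi> where "\<pi> = (\<lambda>w. R #>\<^bsub>F\<^esub> w)"
  interpret pi: group_hom F G \<pi>
    unfolding \<pi>_def using R.r_coset_hom_Mod G_eq
    by (intro group_hom.intro group_hom_axioms.intro F.is_group G.is_group) simp
  have pi_onto: "\<pi> ` carrier F = carrier G" by (simp add: G_eq carrier_FactGroup \<pi>_def)
  have RDF: "R \<subseteq> DF"
    unfolding R_def DF_def using F.exp_derived_antimono[of 1 d] assms(2) by simp
  have pi_DF: "\<pi> ` DF = DG"
    unfolding DF_def DG_def using pi.derived_img[of "carrier F"] pi_onto by simp
  have pi_eq: "inv\<^bsub>F\<^esub> v \<otimes>\<^bsub>F\<^esub> w \<in> R" if "v \<in> carrier F" "w \<in> carrier F" "\<pi> w = \<pi> v" for v w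
  proof -
    have "w \<otimes>\<^bsub>F\<^esub> inv\<^bsub>F\<^esub> v \<in> R"
      using that F.rcos_self[OF that(2) R.is_subgroup] R.rcos_module_imp[OF F.is_group]
      by (simp add: \<pi>_def)
    then have "inv\<^bsub>F\<^esub> v \<otimes>\<^bsub>F\<^esub> (w \<otimes>\<^bsub>F\<^esub> inv\<^bsub>F\<^esub> v) \<otimes>\<^bsub>F\<^esub> v \<in> R"
      using R.inv_op_closed1 that by blast
    then show ?thesis using that by (simp add: F.m_assoc)
  qed
  have DF_sub: "subgroup DF F"
    unfolding DF_def by (rule F.derived_is_subgroup) simp
  \<comment> \<open>As \<open>R \<subseteq> DF\<close>, membership in \<open>DG\<close> can be
    tested on any preimage.\<close>
  have pi_DG: "w \<in> DF" if w: "w \<in> carrier F" "\<pi> w \<in> DG" for w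
  proof -
    obtain v where v: "v \<in> DF" "\<pi> w = \<pi> v" using w(2) pi_DF by blast
    have vc: "v \<in> carrier F" using v(1) subgroup.mem_carrier[OF DF_sub] by blast
    have "v \<otimes>\<^bsub>F\<^esub> (inv\<^bsub>F\<^esub> v \<otimes>\<^bsub>F\<^esub> w) \<in> DF"
      using pi_eq[OF vc w(1) v(2)] RDF v(1) subgroup.m_closed[OF DF_sub] by blast
    then show ?thesis using vc w(1) by (simp flip: F.m_assoc)
  qed
  have H: "subgroup H G" and fg: "finitely_generated_subgroup G H"
    and vc: "verbally_closed G H" and rab: "r_ab G H = 1"
    using assms by (simp_all add: G_def)
  have HC: "x \<in> carrier G" if "x \<in> H" for x using that subgroup.mem_carrier[OF H] by blast
  obtain h where h: "h \<in> H" "h \<notin> DG"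
    and cyc: "\<And>x. x \<in> H \<Longrightarrow> \<exists>k::int. x \<otimes>\<^bsub>G\<^esub> inv\<^bsub>G\<^esub> (h [^]\<^bsub>G\<^esub> k) \<in> DG"
    using G.r_ab_eq_1[OF H fg rab] unfolding DG_def by blast
  have hG: "h \<in> carrier G" using HC h(1) .
  obtain h0 where h0: "h0 \<in> carrier F" "h = \<pi> h0" using hG pi_onto by blast
  have "h0 \<notin> DF" using h(2) h0(2) pi_DF by blast
  then obtain c m g where m: "m > 0" "F.exponent_sum c h0 = int m" and g: "g \<in> carrier F"
    and hg: "h0 \<otimes>\<^bsub>F\<^esub> inv\<^bsub>F\<^esub> (g [^]\<^bsub>F\<^esub> m) \<in> DF"
    using F.power_mod_derived[OF _ h0(1)] unfolding DF_def by blast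
  \<comment> \<open>The weighted exponent sum vanishes on \<open>DF\<close>, hence on
    \<open>R\<close>, and so descends to \<open>G\<close>.\<close>
  obtain \<chi> where chi: "\<chi> \<in> hom G integer_group"
    and chi_pi: "\<And>w. w \<in> carrier F \<Longrightarrow> \<chi> (\<pi> w) = F.exponent_sum c w"
  proof (rule FactGroup_universal[OF group_hom.homh[OF F.exponent_sum_hom[of c]] R.normal_axioms])
    fix v w assume vw: "v \<in> carrier F" "w \<in> carrier F" "R #>\<^bsub>F\<^esub> v = R #>\<^bsub>F\<^esub> w"
    then have "inv\<^bsub>F\<^esub> w \<otimes>\<^bsub>F\<^esub> v \<in> DF" using pi_eq[of w v] RDF by (auto simp: \<pi>_def)
    then have "F.exponent_sum c (inv\<^bsub>F\<^esub> w \<otimes>\<^bsub>F\<^esub> v) = 0"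
      unfolding DF_def by (rule F.exponent_sum_derived)
    then show "F.exponent_sum c v = F.exponent_sum c w"
      using vw by (simp add: F.exponent_sum_mult F.exponent_sum_inv)
  qed (auto simp: G_eq \<pi>_def)
  interpret chi: group_hom G integer_group \<chi>
    using chi by (intro group_hom.intro group_hom_axioms.intro G.is_group) auto
  have chi_DG: "\<chi> x = 0" if "x \<in> DG" for x
  proof -
    obtain w where w: "w \<in> DF" "x = \<pi> w" using \<open>x \<in> DG\<close> pi_DF by blast
    then show ?thesis
      using chi_pi[of w] F.exponent_sum_derived[of w c] subgroup.mem_carrier[OF DF_sub]
      by (simp add: DF_def)
  qed
  have chi_h: "\<chi> h = int m" using chi_pi[OF h0(1)] h0(2) m(2) by simp
  have chi_pow: "\<chi> (h [^]\<^bsub>G\<^esub> k) = k * int m" for k :: int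
    using chi.hom_int_pow[OF hG] chi_h by simp
  interpret DG: normal DG G unfolding DG_def by (rule G.derived_self_is_normal)
  have DHG: "derived G H \<subseteq> DG"
    unfolding DG_def using G.mono_derived subgroup.subset[OF H] by blast

  \<comment> \<open>Modulo \<open>DG\<close>, \<open>h\<close> is the \<open>m\<close>-th power of
    \<open>\<pi> g\<close>; by verbal closedness it is the \<open>m\<close>-th power of some
    \<open>u \<in> H\<close>, and then \<open>\<chi> u = 1\<close>. But \<open>u\<close> is a power
    of \<open>h\<close> modulo \<open>DG\<close>, so \<open>m\<close> divides
    \<open>\<chi> u\<close>.\<close>
  have "m = 1"
  proof -
    define y where "y = \<pi> g [^]\<^bsub>G\<^esub> m"
    have y: "y \<in> carrier G" using g by (simp add: y_def)
    have "\<pi> (h0 \<otimes>\<^bsub>F\<^esub> inv\<^bsub>F\<^esub> (g [^]\<^bsub>F\<^esub> m)) \<in> DG" using hg pi_DF by blast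
    then have "h \<otimes>\<^bsub>G\<^esub> inv\<^bsub>G\<^esub> y \<in> DG"
      using g h0 by (simp add: y_def pi.hom_nat_pow)
    then have "inv\<^bsub>G\<^esub> y \<otimes>\<^bsub>G\<^esub> (h \<otimes>\<^bsub>G\<^esub> inv\<^bsub>G\<^esub> y) \<otimes>\<^bsub>G\<^esub> y \<in> DG"
      using DG.inv_op_closed1 y by blast
    then have z: "inv\<^bsub>G\<^esub> y \<otimes>\<^bsub>G\<^esub> h \<in> DG" using y hG by (simp add: G.m_assoc)
    have hy: "h = y \<otimes>\<^bsub>G\<^esub> (inv\<^bsub>G\<^esub> y \<otimes>\<^bsub>G\<^esub> h)" using y hG by (simp flip: G.m_assoc)
    then obtain u z' where u: "u \<in> H" "z' \<in> derived G H" "h = u [^]\<^bsub>G\<^esub> m \<otimes>\<^bsub>G\<^esub> z'"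
      using G.verbally_closed_power_commutator[OF H vc, of "\<pi> g" m "inv\<^bsub>G\<^esub> y \<otimes>\<^bsub>G\<^esub> h"]
        z h(1) g unfolding y_def DG_def by auto
    have uG: "u \<in> carrier G" and z': "z' \<in> DG" using u HC DHG by auto
    have "int m = int m * \<chi> u"
      using chi_h u(3) uG z' chi_DG[OF z'] chi.hom_nat_pow[OF uG] by simp
    then have 1: "\<chi> u = 1" using m(1) by simp
    obtain k where k: "u \<otimes>\<^bsub>G\<^esub> inv\<^bsub>G\<^esub> (h [^]\<^bsub>G\<^esub> (k::int)) \<in> DG" using cyc[OF u(1)] by blast
    have "\<chi> u - k * int m = 0"
      using chi_DG[OF k] uG hG chi_pow by simp
    then have "k * int m = 1" using 1 by simp
    then show ?thesis using zmult_eq_1_iff[of k "int m"] by auto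
  qed
  then have chi_pow': "\<chi> (h [^]\<^bsub>G\<^esub> k) = k" for k :: int using chi_pow by simp

  define K where "K = {w \<in> carrier F. \<pi> w \<in> H}"
  have K: "subgroup K F"
  proof (rule F.subgroupI)
    have "\<one>\<^bsub>F\<^esub> \<in> K" using subgroup.one_closed[OF H] by (simp add: K_def)
    then show "K \<noteq> {}" by blast
    show "K \<subseteq> carrier F" by (auto simp: K_def)
    show "inv\<^bsub>F\<^esub> a \<in> K" if "a \<in> K" for a
      using that subgroup.m_inv_closed[OF H] by (simp add: K_def)
    show "a \<otimes>\<^bsub>F\<^esub> b \<in> K" if "a \<in> K" "b \<in> K" for a b
      using that subgroup.m_closed[OF H] by (simp add: K_def)
  qed
  have pi_K: "\<pi> ` K = H"
  proof
    show "H \<subseteq> \<pi> ` K"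
    proof
      fix x assume x: "x \<in> H"
      then have "x \<in> \<pi> ` carrier F" using HC pi_onto by simp
      then obtain w where "w \<in> carrier F" "x = \<pi> w" by (rule imageE)
      then show "x \<in> \<pi> ` K" using x by (simp add: K_def)
    qed
  qed (auto simp: K_def)
  have KC: "K \<subseteq> carrier F" by (auto simp: K_def)
  \<comment> \<open>The question is lifted to the full preimage \<open>K\<close> of \<open>H\<close>
    in the free group, where the flow argument applies.\<close>
  have trivial: "x = \<one>\<^bsub>G\<^esub>" if x: "x \<in> H" "x \<in> DG" for x
  proof -
    have "K \<inter> DF \<subseteq> R"
      unfolding DF_def R_def
    proof (rule F.inter_derived_subset_exp_derived[OF K, of h0])
      show "h0 \<in> K" using h0 h(1) by (simp add: K_def)
      show "k = 0" if "h0 [^]\<^bsub>F\<^esub> k \<in> derived F (carrier F)" for k :: int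
        using F.exponent_sum_derived[OF that, of c] F.exponent_sum_int_pow[OF h0(1)] m by simp
      show "\<exists>k::int. a \<otimes>\<^bsub>F\<^esub> inv\<^bsub>F\<^esub> (h0 [^]\<^bsub>F\<^esub> k) \<in> derived F (carrier F)" if a: "a \<in> K" for a
      proof -
        have ac: "a \<in> carrier F" using a KC by blast
        obtain k where "\<pi> a \<otimes>\<^bsub>G\<^esub> inv\<^bsub>G\<^esub> (h [^]\<^bsub>G\<^esub> (k::int)) \<in> DG"
          using cyc[of "\<pi> a"] a by (auto simp: K_def)
        then have "\<pi> (a \<otimes>\<^bsub>F\<^esub> inv\<^bsub>F\<^esub> (h0 [^]\<^bsub>F\<^esub> k)) \<in> DG"
          using ac h0 by (simp add: pi.hom_int_pow)
        then have "a \<otimes>\<^bsub>F\<^esub> inv\<^bsub>F\<^esub> (h0 [^]\<^bsub>F\<^esub> k) \<in> DF"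
          using ac h0(1) by (intro pi_DG) auto
        then show ?thesis unfolding DF_def by (rule exI)
      qed
      show "\<exists>c\<in>derived F K. \<exists>z\<in>(derived F ^^ d) (carrier F). w = c \<otimes>\<^bsub>F\<^esub> z"
        if w: "w \<in> K" "w \<in> derived F (carrier F)" for w
      proof -
        have wc: "w \<in> carrier F" "\<pi> w \<in> H" using w(1) by (auto simp: K_def)
        have wD: "\<pi> w \<in> derived G (carrier G)" 
          using imageI[OF w(2)[folded DF_def], of \<pi>] pi_DF by (simp add: DG_def)
        \<comment> \<open>Exponent 0 removes the power factor and leaves
          \<open>\<pi> w \<in> derived G H\<close>.\<close>
        have wG: "\<one>\<^bsub>G\<^esub> [^]\<^bsub>G\<^esub> (0::nat) \<otimes>\<^bsub>G\<^esub> \<pi> w = \<pi> w" using wc(1) by simp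
        obtain u z where uz: "u \<in> H" "z \<in> derived G H" "\<pi> w = u [^]\<^bsub>G\<^esub> (0::nat) \<otimes>\<^bsub>G\<^esub> z"
          using G.verbally_closed_power_commutator[OF H vc, of "\<one>\<^bsub>G\<^esub>" 0 "\<pi> w", unfolded wG]
            wc(2) wD G.one_closed by meson
        then have "\<pi> w \<in> derived G H"
          using G.derived_in_carrier[OF subgroup.subset[OF H]] by auto
        then have "\<pi> w \<in> \<pi> ` derived F K" using pi.derived_img[OF KC] pi_K by simp
        then obtain v where v: "\<pi> w = \<pi> v" "v \<in> derived F K" by (rule imageE)
        have vc: "v \<in> carrier F" using v(2) F.derived_in_carrier[OF KC] by blast
        have "inv\<^bsub>F\<^esub> v \<otimes>\<^bsub>F\<^esub> w \<in> R" using pi_eq[OF vc wc(1) v(1)] .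
        moreover have "w = v \<otimes>\<^bsub>F\<^esub> (inv\<^bsub>F\<^esub> v \<otimes>\<^bsub>F\<^esub> w)" using vc wc(1) by (simp flip: F.m_assoc)
        ultimately show ?thesis using v(2) unfolding R_def by blast
      qed
    qed
    moreover obtain w where w: "x = \<pi> w" "w \<in> K" using x(1) unfolding pi_K[symmetric] by (rule imageE)
    moreover have "w \<in> DF" using w x(2) KC by (intro pi_DG) auto
    ultimately have "w \<in> R" by blast
    then show ?thesis using w(1) R.rcos_const[OF F.is_group] by (simp add: \<pi>_def G_eq)
  qed

  \<comment> \<open>Since \<open>H\<close> meets \<open>DG\<close> trivially, every element of
    \<open>H\<close> is some \<open>h [^] k\<close>, and \<open>\<chi>\<close> recovers
    \<open>k\<close> because \<open>m = 1\<close>.\<close>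
  define \<rho> where "\<rho> x = h [^]\<^bsub>G\<^esub> \<chi> x" for x
  have "\<rho> \<in> hom G G"
    by (rule homI) (auto simp: \<rho>_def hG G.int_pow_mult)
  moreover have "\<rho> ` carrier G \<subseteq> H"
    using G.subgroup_int_pow_closed[OF H h(1)] by (auto simp: \<rho>_def)
  moreover have "\<rho> x = x" if x: "x \<in> H" for x
  proof -
    obtain k where k: "x \<otimes>\<^bsub>G\<^esub> inv\<^bsub>G\<^esub> (h [^]\<^bsub>G\<^esub> (k::int)) \<in> DG" using cyc[OF x] by blast
    have "x \<otimes>\<^bsub>G\<^esub> inv\<^bsub>G\<^esub> (h [^]\<^bsub>G\<^esub> k) \<in> H"
      using x G.subgroup_int_pow_closed[OF H h(1)]
      by (auto intro: subgroup.m_closed[OF H] subgroup.m_inv_closed[OF H])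
    then have "x \<otimes>\<^bsub>G\<^esub> inv\<^bsub>G\<^esub> (h [^]\<^bsub>G\<^esub> k) = \<one>\<^bsub>G\<^esub>" using trivial k by blast
    then have "x = h [^]\<^bsub>G\<^esub> k"
      using HC[OF x] hG by (metis G.int_pow_closed G.inv_closed G.inv_equality G.inv_inv)
    then show ?thesis using chi_pow' by (simp add: \<rho>_def)
  qed
  ultimately show ?thesis unfolding is_retract_def G_def by blast
qed

end
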